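(* Let $f:\mathbb{R}^d\to\mathbb{R}\cup\{\infty\}$ be convex and $\ell$-smooth, attaining its minimum at $x^*\in\mathbb{R}^d$, let $x^0\in\mathcal{X}$, $\Delta:=f(x^0)-f(x^* )$, and let $\bar R>0$ satisfy $\bar R\ge\|x^0-x^*\|$. Let $\psi:\mathbb{R}_+\to\mathbb{R}_+$, $\psi(x)=\frac{x^2}{2\ell(4x)}$ (not necessarily strictly increasing), and let $\Delta_{\max}\in(0,\infty]$ be the largest value such that $\psi$ is strictly increasing on $[0,\Delta_{\max})$. For $\delta\in[0,\psi(\Delta_{\max}))$ let $\Delta_{\mathrm{left}}(\delta)\in[0,\Delta_{\max})$ be the unique point and $\Delta_{\mathrm{right}}(\delta)\in[\Delta_{\max},\infty]$ the smallest point such that $\psi(\Delta_{\mathrm{left}}(\delta))=\delta$ and $\psi(\Delta_{\mathrm{right}}(\delta))=\delta$ (with $\Delta_{\mathrm{right}}(\delta)=\infty$ if $\{x\in[\Delta_{\max},\infty):\psi(x)=\delta\}$ is empty). Let $$M_{\bar R}:=\max_{f(x)-f(x^* )\le\Delta,\ \|x-x^*\|\le 2\bar R}\|\nabla f(x)\|$$ (or let $M_{\bar R}$ be any upper bound on this maximum). Take any $\delta\in\left[0,\frac12\psi(\Delta_{\max})\right]$ such that $\ell(4\Delta_{\mathrm{left}}(\delta))\le 2\ell(0)$, $\Delta_{\mathrm{right}}(\delta)\ge 2M_{\bar R}$, and $\delta\le\Delta$. Then Algorithm 1 run from $x^0$ with parameters $\delta$ and $\bar R$ guarantees that $$f(y^{k+1})-f(x^*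 )\le\Gamma_{k+1}\bar R^2\le\frac{18\,\ell(0)\,\bar R^2}{(k+1-\bar k)^2}$$ for all integers $k\ge\bar k:=\max\left\{1+\frac12\log_{3/2}\left(\frac{\Gamma_0}{8\ell(0)}\right),0\right\}$.
   Context: $\|\cdot\|$ is the Euclidean norm for vectors and the spectral norm for matrices; $\mathbb{R}_+=[0,\infty)$. If $\Delta_{\max}=\infty$, then $\psi(\Delta_{\max})$ means $\lim_{x\to\infty}\psi(x)\in(0,\infty]$, $\Delta_{\mathrm{right}}(\delta)=\infty$, and $\delta$ is always finite. Setting: $f:\mathbb{R}^d\to\mathbb{R}\cup\{\infty\}$, $\mathcal{X}:=\{x\in\mathbb{R}^d: f(x)<\infty\}$ is assumed to be an open, $d$-dimensional (nonempty) convex set, and $\bar{\mathcal{X}}$ denotes its closure; $\mathrm{Proj}_{\bar{\mathcal{X}}}$ is the Euclidean projection onto $\bar{\mathcal{X}}$. $f$ is $\ell$-smooth if $f$ is twice differentiable on $\mathcal{X}$, continuous on $\bar{\mathcal{X}}$, and $\ell:[0,\infty)\to(0,\infty)$ is a non-decreasing, positive, locally Lipschitz function with $\|\nabla^2 f(x)\|\le \ell(\|\nabla f(x)\|)$ for all $x\in\mathcal{X}$. Algorithm 1 (input: $x^0\in\mathcal{X}$, $\ell$, $\delta$, $\bar R$). Phase 1: starting from $x^0$, run gradient descent (GD) $x^{j+1}=x^j-\eta_j\nabla f(x^j)$ with $\eta_j=\int_0^1\frac{dv}{\ell(\|\nabla f(x^j)\|+\|\nabla f(x^j)\|v)}$ until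 a point $\bar x$ with $f(\bar x)-f(x^* )\le\delta/2$ is reached. Phase 2: set $y^0=u^0=\bar x$, $\Gamma_0=\delta/\bar R^2$, $\gamma=1/(2\ell(0))$, and for $k=0,1,2,\dots$: $\alpha_k=\sqrt{\gamma\Gamma_k}$; $y^{k+1}=\frac{1}{1+\alpha_k}y^k+\frac{\alpha_k}{1+\alpha_k}u^k-\frac{\gamma}{1+\alpha_k}\nabla f(y^k)$; $u^{k+1}=\mathrm{Proj}_{\bar{\mathcal{X}}}\left(u^k-\frac{\alpha_k}{\Gamma_k}\nabla f(y^{k+1})\right)$; $\Gamma_{k+1}=\Gamma_k/(1+\alpha_k)$. In the degenerate case $\delta=0$ the guarantee presupposes that Phase 1 terminates (so $\bar x$ is a minimizer), with $\log 0=-\infty$ and $\frac{\alpha_k}{\Gamma_k}\nabla f(y^{k+1})$ read as $0$ (all iterates stay at $\bar x$). *)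

theory Defs
  imports "HOL-Analysis.Analysis"
begin

definition dom_fin :: "('a \<Rightarrow> ereal) \<Rightarrow> 'a set" where
  "dom_fin f = {x. f x < \<infinity>}"

text \<open>At the end points of the unit interval this uses \<open>0 * \<infinity> = 0\<close> in \<^typ>\<open>ereal\<close>, so that
  the condition is trivial there.\<close>
definition convex_ext :: "('a::real_vector \<Rightarrow> ereal) \<Rightarrow> bool" where
  "convex_ext f \<longleftrightarrow>
     (\<forall>x y. \<forall>t\<in>{0..1::real}.
        f ((1 - t) *\<^sub>R x + t *\<^sub>R y) \<le> ereal (1 - t) * f x + ereal t * f y)"

text \<open>The gradient is meaningful only at interior points of \<^term>\<open>dom_fin f\<close>.\<close>
definition grad :: "('a::euclidean_space \<Rightarrow> ereal) \<Rightarrow> 'a \<Rightarrow> 'a" where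
  "grad f x = (THE g. GDERIV (\<lambda>z. real_of_ereal (f z)) x :> g)"

definition hess :: "('a::euclidean_space \<Rightarrow> ereal) \<Rightarrow> 'a \<Rightarrow> 'a \<Rightarrow> 'a" where
  "hess f x = frechet_derivative (grad f) (at x)"

text \<open>The domain is open, so \<open>f = \<infinity>\<close> on its frontier, and continuity on the closure (as an
  \<^typ>\<open>ereal\<close>-valued function) means that \<open>f\<close> blows up there. The operator norm
  \<^const>\<open>onorm\<close> of the Hessian, as a linear map, is the spectral norm.\<close>
definition gen_smooth :: "(real \<Rightarrow> real) \<Rightarrow> ('a::euclidean_space \<Rightarrow> ereal) \<Rightarrow> bool" where
  "gen_smooth l f \<longleftrightarrow>
     (\<forall>x\<in>dom_fin f. (\<lambda>z. real_of_ereal (f z)) differentiable (at x)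
                    \<and> grad f differentiable (at x)) \<and>
     continuous_on (closure (dom_fin f)) f \<and>
     mono_on {0..} l \<and>
     (\<forall>s\<ge>0. 0 < l s) \<and>
     (\<forall>s\<ge>0. \<exists>e>0. \<exists>L. L-lipschitz_on (cball s e \<inter> {0..}) l) \<and>
     (\<forall>x\<in>dom_fin f. onorm (hess f x) \<le> l (norm (grad f x)))"

definition psi :: "(real \<Rightarrow> real) \<Rightarrow> real \<Rightarrow> real" where
  "psi l x = x\<^sup>2 / (2 * l (4 * x))"

definition Delta_max :: "(real \<Rightarrow> real) \<Rightarrow> ereal" where
  "Delta_max l =
     (GREATEST D. 0 < D \<and> strict_mono_on {x. 0 \<le> x \<and> ereal x < D} (psi l))"

text \<open>If \<open>\<Delta>\<^sub>m\<^sub>a\<^sub>x = \<infinity>\<close>, then \<open>\<psi>\<close> is increasing on \<open>[0,\<infinity>)\<close>, so the limit exists in \<^typ>\<open>ereal\<close>.\<close>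
definition psi_Delta_max :: "(real \<Rightarrow> real) \<Rightarrow> ereal" where
  "psi_Delta_max l =
     (if Delta_max l = \<infinity> then Lim at_top (\<lambda>x. ereal (psi l x))
      else ereal (psi l (real_of_ereal (Delta_max l))))"

definition Delta_left :: "(real \<Rightarrow> real) \<Rightarrow> real \<Rightarrow> real" where
  "Delta_left l \<delta> = (THE x. 0 \<le> x \<and> ereal x < Delta_max l \<and> psi l x = \<delta>)"

definition Delta_right :: "(real \<Rightarrow> real) \<Rightarrow> real \<Rightarrow> ereal" where
  "Delta_right l \<delta> =
     (if \<exists>x. Delta_max l \<le> ereal x \<and> psi l x = \<delta>
      then ereal (LEAST x. Delta_max l \<le> ereal x \<and> psi l x = \<delta>)
      else \<infinity>)"

definition gd_step :: "(real \<Rightarrow> real) \<Rightarrow> 'a::euclidean_space \<Rightarrow> real" where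
  "gd_step l g = integral {0..1} (\<lambda>v. 1 / l (norm g + norm g * v))"

primrec gd_iter :: "(real \<Rightarrow> real) \<Rightarrow> ('a::euclidean_space \<Rightarrow> ereal) \<Rightarrow> 'a \<Rightarrow> nat \<Rightarrow> 'a" where
  "gd_iter l f x0 0 = x0"
| "gd_iter l f x0 (Suc j) =
     gd_iter l f x0 j
       - gd_step l (grad f (gd_iter l f x0 j)) *\<^sub>R grad f (gd_iter l f x0 j)"

definition phase1_reached ::
  "(real \<Rightarrow> real) \<Rightarrow> ('a::euclidean_space \<Rightarrow> ereal) \<Rightarrow> 'a \<Rightarrow> 'a \<Rightarrow> real \<Rightarrow> nat \<Rightarrow> bool" where
  "phase1_reached l f xs x0 \<delta> j \<longleftrightarrow> f (gd_iter l f x0 j) - f xs \<le> ereal (\<delta> / 2)"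

definition phase1_point ::
  "(real \<Rightarrow> real) \<Rightarrow> ('a::euclidean_space \<Rightarrow> ereal) \<Rightarrow> 'a \<Rightarrow> 'a \<Rightarrow> real \<Rightarrow> 'a" where
  "phase1_point l f xs x0 \<delta> = gd_iter l f x0 (LEAST j. phase1_reached l f xs x0 \<delta> j)"

definition acc_gamma :: "(real \<Rightarrow> real) \<Rightarrow> real" where
  "acc_gamma l = 1 / (2 * l 0)"

primrec acc_Gamma :: "(real \<Rightarrow> real) \<Rightarrow> real \<Rightarrow> real \<Rightarrow> nat \<Rightarrow> real" where
  "acc_Gamma l \<delta> R 0 = \<delta> / R\<^sup>2"
| "acc_Gamma l \<delta> R (Suc k) =
     acc_Gamma l \<delta> R k / (1 + sqrt (acc_gamma l * acc_Gamma l \<delta> R k))"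

definition acc_alpha :: "(real \<Rightarrow> real) \<Rightarrow> real \<Rightarrow> real \<Rightarrow> nat \<Rightarrow> real" where
  "acc_alpha l \<delta> R k = sqrt (acc_gamma l * acc_Gamma l \<delta> R k)"

text \<open>The pair \<open>(y\<^sup>k, u\<^sup>k)\<close>, started at the point \<open>xb\<close>. For \<open>\<delta> = 0\<close> all \<open>\<Gamma>\<^sub>k\<close> and \<open>\<alpha>\<^sub>k\<close>
  vanish, and \<open>\<alpha>\<^sub>k / \<Gamma>\<^sub>k = 0 / 0 = 0\<close> is the intended reading.\<close>
primrec acc_iter ::
  "(real \<Rightarrow> real) \<Rightarrow> ('a::euclidean_space \<Rightarrow> ereal) \<Rightarrow> real \<Rightarrow> real \<Rightarrow> 'a \<Rightarrow> nat \<Rightarrow> 'a \<times> 'a" where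
  "acc_iter l f \<delta> R xb 0 = (xb, xb)"
| "acc_iter l f \<delta> R xb (Suc k) =
     (let y = fst (acc_iter l f \<delta> R xb k);
          u = snd (acc_iter l f \<delta> R xb k);
          \<alpha> = acc_alpha l \<delta> R k;
          \<Gamma> = acc_Gamma l \<delta> R k;
          y' = (1 / (1 + \<alpha>)) *\<^sub>R y + (\<alpha> / (1 + \<alpha>)) *\<^sub>R u
                 - (acc_gamma l / (1 + \<alpha>)) *\<^sub>R grad f y;
          u' = closest_point (closure (dom_fin f)) (u - (\<alpha> / \<Gamma>) *\<^sub>R grad f y')
      in (y', u'))"

definition alg_y ::
  "(real \<Rightarrow> real) \<Rightarrow> ('a::euclidean_space \<Rightarrow> ereal) \<Rightarrow> 'a \<Rightarrow> 'a \<Rightarrow> real \<Rightarrow> real \<Rightarrow> nat \<Rightarrow> 'a" where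
  "alg_y l f xs x0 \<delta> R k = fst (acc_iter l f \<delta> R (phase1_point l f xs x0 \<delta>) k)"

text \<open>The case distinction implements \<open>log 0 = -\<infinity>\<close> (in HOL, \<open>log b 0 = 0\<close>).\<close>
definition k_bar :: "(real \<Rightarrow> real) \<Rightarrow> real \<Rightarrow> real \<Rightarrow> real" where
  "k_bar l \<delta> R =
     (if acc_Gamma l \<delta> R 0 = 0 then 0
      else max (1 + 1/2 * log (3/2) (acc_Gamma l \<delta> R 0 / (8 * l 0))) 0)"

end

theory Submission
  imports Defs
begin

text \<open>
  Moving from \<open>x\<close> against a unit vector \<open>e\<close> with speed \<open>1 / l (\<parallel>\<nabla>f x\<parallel> + s)\<close> changes the gradient by
  at most \<open>s\<close>, because the Hessian bound then cancels the speed. Taking \<open>e\<close> in the direction of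
  \<open>\<nabla>f x - v\<close> and integrating the decrease of \<open>f - v \<bullet> _\<close> gives both the descent property of the
  gradient step (\<open>v = 0\<close>) and, for \<open>v = \<nabla>f y\<close>, the cocoercivity inequality
  \<open>f y + \<nabla>f y \<bullet> (x - y) + r\<^sup>2 / (2 l (\<parallel>\<nabla>f x\<parallel> + r)) \<le> f x\<close> with \<open>r = \<parallel>\<nabla>f x - \<nabla>f y\<parallel>\<close>. Hence gradient
  descent approaches \<open>x\<^sup>*\<close> monotonically and reaches the gap \<open>\<delta> / 2\<close>. The same inequality gives
  \<open>\<psi> \<parallel>\<nabla>f x\<parallel> \<le> f x - f x\<^sup>*\<close>, so that at the end of Phase 1 the bound \<open>M\<close> excludes the branch beyond
  \<open>\<Delta>\<^sub>r\<^sub>i\<^sub>g\<^sub>h\<^sub>t\<close> and leaves \<open>\<parallel>\<nabla>f x\<parallel> \<le> \<Delta>\<^sub>l\<^sub>e\<^sub>f\<^sub>t\<close>. In Phase 2 this gradient bound is kept by a continuity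
  argument along a path from \<open>y\<^sup>k\<close> to \<open>y\<^sup>k\<^sup>+\<^sup>1\<close>; there \<open>f\<close> behaves like a \<open>2 l 0\<close>-smooth function and the
  potential \<open>f y\<^sup>k - f x\<^sup>* + \<Gamma>\<^sub>k \<parallel>u\<^sup>k - x\<^sup>*\<parallel>\<^sup>2 / 2\<close> contracts by the factor \<open>1 / (1 + \<alpha>\<^sub>k)\<close>.
\<close>

section \<open>Continuation along a real interval, and one-sided limits\<close>

lemma real_continuation:
  fixes P :: "real \<Rightarrow> bool"
  assumes start: "P a"
    and limit: "\<And>t. a < t \<Longrightarrow> t \<le> b \<Longrightarrow> (\<And>s. a \<le> s \<Longrightarrow> s < t \<Longrightarrow> P s) \<Longrightarrow> P t"
    and step: "\<And>t. a \<le> t \<Longrightarrow> t < b \<Longrightarrow> P t \<Longrightarrow> \<forall>\<^sub>F s in at_right t. P s"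
    and t: "a \<le> t" "t \<le> b"
  shows "P t"
proof (rule ccontr)
  assume "\<not> P t"
  \<comment> \<open>The infimum \<open>m\<close> of the failure set still satisfies
    \<open>P\<close>, by \<open>start\<close> or \<open>limit\<close>. Then \<open>step\<close>
    carries \<open>P\<close> strictly past \<open>m\<close>, so \<open>m\<close> is not the
    infimum.\<close>
  define B where "B = {s \<in> {a..b}. \<not> P s}"
  define m where "m = Inf B"
  have tB: "t \<in> B" using t \<open>\<not> P t\<close> by (auto simp: B_def)
  have bdd: "bdd_below B" by (rule bdd_belowI[of _ a]) (auto simp: B_def)
  have ma: "a \<le> m" unfolding m_def using tB by (intro cInf_greatest) (auto simp: B_def)
  have mt: "m \<le> t" unfolding m_def using tB bdd by (rule cInf_lower)
  have below: "P s" if "a \<le> s" "s < m" for s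
  proof (rule ccontr)
    assume "\<not> P s"
    moreover have "s \<le> b" using that mt t by linarith
    ultimately have "s \<in> B" using that by (simp add: B_def)
    then have "m \<le> s" unfolding m_def using bdd by (rule cInf_lower)
    then show False using that by simp
  qed
  have Pm: "P m"
  proof (cases "m = a")
    case False
    then show ?thesis using ma mt t below by (auto intro: limit[of m])
  qed (use start in simp)
  then have "m < b" using \<open>\<not> P t\<close> mt t by (cases "m = t") auto
  then obtain c where c: "c > m" "\<And>s. m < s \<Longrightarrow> s < c \<Longrightarrow> P s"
    using step[OF ma _ Pm] by (auto simp: eventually_at_right_field)
  have "c \<le> m"
    unfolding m_def
  proof (rule cInf_greatest)
    fix s assume s: "s \<in> B"
    then have "m \<le> s" unfolding m_def using bdd by (rule cInf_lower)
    moreover have "s \<noteq> m" using s Pm by (auto simp: B_def)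
    ultimately show "c \<le> s" using c(2)[of s] s by (force simp: B_def)
  qed (use tB in auto)
  then show False using c by simp
qed

lemma continuous_on_atLeast_at_right:
  fixes h :: "real \<Rightarrow> 'b::topological_space"
  assumes "continuous_on {b..} h" "b \<le> a"
  shows "(h \<longlongrightarrow> h a) (at_right a)"
proof -
  have "(h \<longlongrightarrow> h a) (at a within {b..})" using assms by (simp add: continuous_on_def)
  then show ?thesis by (rule tendsto_within_subset) (use assms(2) in auto)
qed

section \<open>Descent along a gradient-controlled path\<close>

locale gen_smooth_fun =
  fixes X :: "'a::euclidean_space set"
    and F :: "'a \<Rightarrow> real"
    and g :: "'a \<Rightarrow> 'a"
    and H :: "'a \<Rightarrow> 'a \<Rightarrow> 'a"
    and l :: "real \<Rightarrow> real"
  assumes open_X: "open X"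
    and F_deriv: "x \<in> X \<Longrightarrow> (F has_derivative (\<lambda>h. h \<bullet> g x)) (at x)"
    and g_deriv: "x \<in> X \<Longrightarrow> (g has_derivative H x) (at x)"
    and tangent: "x \<in> X \<Longrightarrow> y \<in> X \<Longrightarrow> F x + g x \<bullet> (y - x) \<le> F y"
    \<comment> \<open>The blow-up of the extended-valued function on the frontier of its open domain.\<close>
    and closed_sublevel: "closed {x \<in> X. F x \<le> c}"
    and H_bound: "x \<in> X \<Longrightarrow> onorm (H x) \<le> l (norm (g x))"
    and l_mono: "0 \<le> s \<Longrightarrow> s \<le> t \<Longrightarrow> l s \<le> l t"
    and l_pos: "0 \<le> s \<Longrightarrow> 0 < l s"
    and l_cont: "continuous_on {0..} l"
begin

lemma F_cont: "x \<in> X \<Longrightarrow> isCont F x"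
  by (rule has_derivative_continuous[OF F_deriv])

lemma g_cont: "x \<in> X \<Longrightarrow> isCont g x"
  by (rule has_derivative_continuous[OF g_deriv])

text \<open>Serves as the barrier at the frontier of \<open>X\<close>: a path with \<open>F\<close>
  bounded above along it cannot leave \<open>X\<close> in the limit.\<close>

lemma sublevel_limit:
  assumes p: "(p \<longlongrightarrow> z) G" "G \<noteq> bot"
    and ev: "\<forall>\<^sub>F s in G. p s \<in> X \<and> F (p s) \<le> c"
  shows "z \<in> X" "F z \<le> c"
  using Lim_in_closed_set[OF closed_sublevel[of c] _ p(2,1)] ev by auto

end

text \<open>The base \<open>a\<close> exceeds \<^term>\<open>norm (g x)\<close> strictly: this slack makes the gradient bound along the
  path an open condition. It is removed by a limit in \<open>generalized_descent\<close>.\<close>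
locale descent_path = gen_smooth_fun X F g H l
  for X :: "'a::euclidean_space set" and F g H l +
  fixes x e v :: 'a and a r :: real
  assumes x: "x \<in> X" and e: "norm e = 1" and gx: "g x = v + r *\<^sub>R e"
    and r: "0 \<le> r" and a: "norm (g x) < a"
begin

text \<open>The path is parametrised by the permitted change of the gradient; as \<open>e\<close> is
  a unit vector, \<open>tau s\<close> is the distance travelled.\<close>

definition tau :: "real \<Rightarrow> real" where
  "tau s = integral {0..s} (\<lambda>\<sigma>. 1 / l (a + \<sigma>))"

definition p :: "real \<Rightarrow> 'a" where
  "p s = x - tau s *\<^sub>R e"

lemma a_pos: "0 < a"
  using a norm_ge_zero[of "g x"] by linarith

lemma speed_cont: "continuous_on {0..b} (\<lambda>\<sigma>. 1 / l (a + \<sigma>))"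
  using a_pos l_pos
  by (intro continuous_intros continuous_on_compose2[OF l_cont]) (auto simp: less_imp_neq[symmetric])

lemma tau_0: "tau 0 = 0"
  by (simp add: tau_def)

lemma p_0: "p 0 = x"
  by (simp add: p_def tau_0)

lemma tau_deriv:
  assumes "s \<in> {0..r}"
  shows "(tau has_derivative (\<lambda>h. h / l (a + s))) (at s within {0..r})"
proof -
  have "(*) (1 / l (a + s)) = (\<lambda>h. h / l (a + s))" by auto
  then show ?thesis
    using integral_has_real_derivative[OF speed_cont assms]
    by (simp add: has_field_derivative_def tau_def[abs_def])
qed

lemma p_deriv:
  "s \<in> {0..r} \<Longrightarrow> (p has_derivative (\<lambda>h. - (h / l (a + s)) *\<^sub>R e)) (at s within {0..r})"
  unfolding p_def
  by (rule has_derivative_eq_rhs[OF has_derivative_diff[OF has_derivative_const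
        has_derivative_scaleR_left[OF tau_deriv]]]) auto

lemma p_cont: "continuous_on {0..r} p"
  by (rule has_derivative_continuous_on[OF p_deriv])

lemma gp_deriv:
  assumes "s \<in> {0..r}" "p s \<in> X"
  shows "((\<lambda>s. g (p s)) has_derivative (\<lambda>h. H (p s) (- (h / l (a + s)) *\<^sub>R e))) (at s within {0..r})"
  by (rule has_derivative_compose[OF p_deriv[OF assms(1)] g_deriv[OF assms(2)]])

text \<open>By monotonicity the Hessian norm at \<open>p s\<close> is at most
  \<open>l (a + s)\<close>, and the speed of the path is exactly the reciprocal.\<close>

lemma gp_deriv_bound:
  assumes "s \<in> {0..r}" "p s \<in> X" "norm (g (p s)) \<le> a + s"
  shows "onorm (\<lambda>h. H (p s) (- (h / l (a + s)) *\<^sub>R e)) \<le> 1"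
proof (rule onorm_le)
  fix h :: real
  have lin: "bounded_linear (H (p s))" using g_deriv[OF assms(2)] has_derivative_bounded_linear by blast
  have las: "0 < l (a + s)" using l_pos a_pos assms by auto
  have "norm (H (p s) (- (h / l (a + s)) *\<^sub>R e)) \<le> onorm (H (p s)) * norm (- (h / l (a + s)) *\<^sub>R e)"
    by (rule onorm[OF lin])
  also have "\<dots> \<le> l (a + s) * norm (- (h / l (a + s)) *\<^sub>R e)"
    using H_bound[OF assms(2)] l_mono[OF norm_ge_zero assms(3)] by (intro mult_right_mono) auto
  also have "\<dots> = \<bar>h\<bar>" using las e by simp
  finally show "norm (H (p s) (- (h / l (a + s)) *\<^sub>R e)) \<le> 1 * norm h" by simp
qed

text \<open>Since \<open>e \<bullet> (g x - v) = r\<close> and the gradient has moved by at most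
  \<open>s\<close>, the function \<open>F - v \<bullet> _\<close> falls along the path at rate at
  least \<open>(r - s) / l (a + r)\<close>. The quantity \<open>q\<close> compensates by the
  integral of this rate and is therefore nonincreasing.\<close>

lemma decrease:
  assumes t: "0 \<le> t" "t \<le> r"
    and good: "\<And>s. 0 \<le> s \<Longrightarrow> s \<le> t \<Longrightarrow> p s \<in> X \<and> norm (g (p s) - g x) \<le> s"
  shows "F (p t) - v \<bullet> p t \<le> F x - v \<bullet> x - (r * t - t\<^sup>2 / 2) / l (a + r)"
proof -
  define q where "q s = F (p s) - v \<bullet> p s + (r * s - s\<^sup>2 / 2) / l (a + r)" for s
  have q: "(q has_derivative (\<lambda>h. h * ((r - s) / l (a + r) - e \<bullet> (g (p s) - v) / l (a + s))))
      (at s within {0..r})" if "s \<in> {0..t}" for s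
  proof -
    have s: "s \<in> {0..r}" "p s \<in> X" using that t good by auto
    have "((\<lambda>s. (r * s - s\<^sup>2 / 2) / l (a + r)) has_derivative (\<lambda>h. h * ((r - s) / l (a + r))))
        (at s within {0..r})"
      using l_pos[of "a + r"] a_pos r
      by (auto intro!: derivative_eq_intros simp: field_simps)
    from has_derivative_add[OF has_derivative_diff[OF has_derivative_compose[OF p_deriv[OF s(1)] F_deriv[OF s(2)]]
        has_derivative_inner_right[OF p_deriv[OF s(1)], of v]] this]
    show ?thesis
      unfolding q_def
      by (rule has_derivative_eq_rhs)
        (auto simp: inner_diff_right algebra_simps inner_commute diff_divide_distrib add_divide_distrib)
  qed
  have "q t \<le> q 0"
  proof (rule DERIV_nonpos_imp_decreasing_open[OF t(1)])
    fix s assume s: "0 < s" "s < t"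
    let ?D = "(r - s) / l (a + r) - e \<bullet> (g (p s) - v) / l (a + s)"
    have "(q has_real_derivative ?D) (at s)"
      using q[of s] s t at_within_Icc_at[of 0 s r] by (simp add: has_field_derivative_def mult_commute_abs)
    moreover have "?D \<le> 0"
    proof -
      have "\<bar>e \<bullet> (g (p s) - g x)\<bar> \<le> s"
        using Cauchy_Schwarz_ineq2[of e "g (p s) - g x"] e good[of s] s by auto
      moreover have "e \<bullet> (g (p s) - v) = e \<bullet> (g (p s) - g x) + r"
        using e by (simp add: gx inner_diff_right inner_add_right power2_norm_eq_inner[symmetric])
      ultimately have "r - s \<le> e \<bullet> (g (p s) - v)" by linarith
      then have "(r - s) / l (a + r) \<le> e \<bullet> (g (p s) - v) / l (a + s)"
        using s t a_pos by (intro frac_le l_mono l_pos) auto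
      then show ?thesis by simp
    qed
    ultimately show "\<exists>y. (q has_real_derivative y) (at s) \<and> y \<le> 0" by blast
  next
    have "(q has_derivative (\<lambda>h. h * ((r - s) / l (a + r) - e \<bullet> (g (p s) - v) / l (a + s))))
      (at s within {0..t})" if "s \<in> {0..t}" for s
      by (rule has_derivative_subset[OF q[OF that]]) (use t in auto)
    then show "continuous_on {0..t} q" by (rule has_derivative_continuous_on)
  qed
  then show ?thesis by (simp add: q_def p_0)
qed

lemma path_good:
  assumes "0 \<le> t" "t \<le> r"
  shows "p t \<in> X \<and> norm (g (p t) - g x) \<le> t"
proof (rule real_continuation[where a = 0 and b = r and P = "\<lambda>t. p t \<in> X \<and> norm (g (p t) - g x) \<le> t"])
  show "p 0 \<in> X \<and> norm (g (p 0) - g x) \<le> 0" using x by (simp add: p_0)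
next
  fix t assume t: "0 < t" "t \<le> r"
    and good: "\<And>s. 0 \<le> s \<Longrightarrow> s < t \<Longrightarrow> p s \<in> X \<and> norm (g (p s) - g x) \<le> s"
  have lim: "(p \<longlongrightarrow> p t) (at_left t)"
    using t by (intro continuous_on_Icc_at_leftD[OF continuous_on_subset[OF p_cont]]) auto
  \<comment> \<open>\<open>decrease\<close> controls \<open>F - v \<bullet> p\<close> only, while
    \<open>sublevel_limit\<close> needs a bound on \<open>F\<close>; compactness of the path bounds
    the linear term.\<close>
  have "bounded (p ` {0..r})"
    by (rule compact_imp_bounded[OF compact_continuous_image[OF p_cont compact_Icc]])
  then obtain B where B: "\<forall>s\<in>{0..r}. norm (p s) \<le> B"
    by (auto simp: bounded_iff)
  have "F (p s) \<le> F x - v \<bullet> x + norm v * B" if s: "0 \<le> s" "s < t" for s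
  proof -
    have "F (p s) - v \<bullet> p s \<le> F x - v \<bullet> x - (r * s - s\<^sup>2 / 2) / l (a + r)"
      by (rule decrease) (use s t good in auto)
    moreover have "0 \<le> (r * s - s\<^sup>2 / 2) / l (a + r)"
    proof -
      have "s * s \<le> r * s" using s t by (intro mult_right_mono) auto
      then have "s\<^sup>2 / 2 \<le> r * s" using s mult_nonneg_nonneg[OF r s(1)] by (simp add: power2_eq_square)
      then show ?thesis using l_pos[of "a + r"] a_pos r by simp
    qed
    moreover have "v \<bullet> p s \<le> norm v * B"
      using norm_cauchy_schwarz[of v "p s"] mult_left_mono[OF bspec[OF B], of s "norm v"] s t by auto
    ultimately show ?thesis by linarith
  qed
  then have "\<forall>\<^sub>F s in at_left t. p s \<in> X \<and> F (p s) \<le> F x - v \<bullet> x + norm v * B"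
    using eventually_at_left[OF t(1)] good t by (auto intro!: exI[of _ 0])
  then have pt: "p t \<in> X" using sublevel_limit[OF lim] by auto
  have "((\<lambda>s. norm (g (p s) - g x)) \<longlongrightarrow> norm (g (p t) - g x)) (at_left t)"
    by (intro tendsto_intros isCont_tendsto_compose[OF g_cont[OF pt]] lim)
  moreover have "((\<lambda>s. s) \<longlongrightarrow> t) (at_left t)" by (rule tendsto_ident_at)
  moreover have "\<forall>\<^sub>F s in at_left t. norm (g (p s) - g x) \<le> s"
    using eventually_at_left[OF t(1)] good t by (auto intro!: exI[of _ 0])
  ultimately have "norm (g (p t) - g x) \<le> t" by (intro tendsto_le[of "at_left t"]) auto
  then show "p t \<in> X \<and> norm (g (p t) - g x) \<le> t" using pt by blast
next
  fix t assume t: "0 \<le> t" "t < r" and Pt: "p t \<in> X \<and> norm (g (p t) - g x) \<le> t"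
  have lim: "(p \<longlongrightarrow> p t) (at_right t)"
    using t by (intro continuous_on_Icc_at_rightD[of t r] continuous_on_subset[OF p_cont]) auto
  have "\<forall>\<^sub>F s in at_right t. p s \<in> X"
    using topological_tendstoD[OF lim open_X] Pt by auto
  \<comment> \<open>Here the strict inequality \<open>norm (g x) < a\<close> is used: the hypothesis
    of \<open>gp_deriv_bound\<close> survives slightly beyond \<open>t\<close>, and the mean value
    inequality on \<open>{t..s}\<close> then extends the gradient estimate.\<close>
  moreover have "\<forall>\<^sub>F s in at_right t. norm (g (p s)) < a + t"
  proof -
    have "norm (g (p t)) < a + t" using Pt a norm_triangle_sub[of "g (p t)" "g x"] by linarith
    moreover have "((\<lambda>s. norm (g (p s))) \<longlongrightarrow> norm (g (p t))) (at_right t)"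
      using Pt by (intro tendsto_intros isCont_tendsto_compose[OF g_cont] lim) auto
    ultimately show ?thesis by (rule order_tendstoD(2)[rotated])
  qed
  ultimately have "\<forall>\<^sub>F s in at_right t. p s \<in> X \<and> norm (g (p s)) < a + t"
    by eventually_elim auto
  then obtain c where c: "c > t" "\<And>s. t < s \<Longrightarrow> s < c \<Longrightarrow> p s \<in> X \<and> norm (g (p s)) < a + t"
    by (auto simp: eventually_at_right_field)
  have "p s \<in> X \<and> norm (g (p s) - g x) \<le> s" if s: "t < s" "s < min c r" for s
  proof -
    have in_X: "p u \<in> X \<and> norm (g (p u)) \<le> a + u" if "u \<in> {t..s}" for u
    proof (cases "u = t")
      case True
      then show ?thesis using Pt a norm_triangle_sub[of "g (p t)" "g x"] by auto
    next
      case False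
      then show ?thesis using c(2)[of u] that s by auto
    qed
    have "norm (g (p s) - g (p t)) \<le> 1 * norm (s - t)"
    proof (rule differentiable_bound[where S = "{t..s}"])
      fix u assume u: "u \<in> {t..s}"
      show "((\<lambda>s. g (p s)) has_derivative (\<lambda>h. H (p u) (- (h / l (a + u)) *\<^sub>R e))) (at u within {t..s})"
        by (rule has_derivative_subset[OF gp_deriv]) (use u s t in_X in auto)
      show "onorm (\<lambda>h. H (p u) (- (h / l (a + u)) *\<^sub>R e)) \<le> 1"
        by (rule gp_deriv_bound) (use u s t in_X in auto)
    qed (use s in auto)
    then have "norm (g (p s) - g x) \<le> s"
      using s Pt norm_triangle_ineq[of "g (p s) - g (p t)" "g (p t) - g x"] by auto
    then show ?thesis using in_X[of s] s by auto
  qed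
  then show "\<forall>\<^sub>F s in at_right t. p s \<in> X \<and> norm (g (p s) - g x) \<le> s"
    unfolding eventually_at_right_field using c t by (intro exI[of _ "min c r"]) auto
qed fact+

lemma endpoint:
  "p r \<in> X" "F (p r) - v \<bullet> p r \<le> F x - v \<bullet> x - r\<^sup>2 / (2 * l (a + r))"
proof -
  have "r * r - r\<^sup>2 / 2 = r\<^sup>2 / 2" by (simp add: power2_eq_square)
  then show "F (p r) - v \<bullet> p r \<le> F x - v \<bullet> x - r\<^sup>2 / (2 * l (a + r))"
    using decrease[OF r order_refl] path_good by simp
  show "p r \<in> X" using path_good[OF r order_refl] by simp
qed

end

section \<open>Descent without slack, and cocoercivity\<close>

context gen_smooth_fun
begin

lemma inv_l_cont:
  assumes "0 \<le> b" "0 \<le> c"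
  shows "continuous_on {0..d} (\<lambda>\<sigma>. 1 / l (b + c * \<sigma>))"
proof -
  have "0 \<le> b + c * \<sigma>" if "0 \<le> \<sigma>" for \<sigma> using assms that by simp
  then show ?thesis
    using l_pos
    by (intro continuous_on_divide continuous_on_const continuous_on_compose2[OF l_cont] continuous_intros)
      (auto simp: less_imp_neq[symmetric])
qed

text \<open>This is \<open>endpoint\<close> in the limit as \<open>a\<close> decreases to
  \<open>norm (g x)\<close>; the length of the path depends continuously on
  \<open>a\<close>.\<close>

lemma generalized_descent:
  assumes x: "x \<in> X" and e: "norm e = 1" and gx: "g x = v + r *\<^sub>R e" and r: "0 \<le> r"
  defines "z \<equiv> x - integral {0..r} (\<lambda>\<sigma>. 1 / l (norm (g x) + \<sigma>)) *\<^sub>R e"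
  shows "z \<in> X" "F z - v \<bullet> z \<le> F x - v \<bullet> x - r\<^sup>2 / (2 * l (norm (g x) + r))"
proof -
  let ?a = "norm (g x)"
  define T where "T a = integral {0..r} (\<lambda>\<sigma>. 1 / l (a + \<sigma>))" for a
  define Z where "Z a = x - T a *\<^sub>R e" for a
  have dp: "descent_path X F g H l x e v a r" if "?a < a" for a
    by unfold_locales (use that x e gx r in auto)
  have "continuous_on {0..} T"
    unfolding T_def box_real(2)[symmetric]
  proof (rule integral_continuous_on_param)
    show "continuous_on ({0..} \<times> cbox 0 r) (\<lambda>(a, \<sigma>). 1 / l (a + \<sigma>))"
      unfolding case_prod_beta
      using l_pos by (intro continuous_on_divide continuous_on_const continuous_on_compose2[OF l_cont]
          continuous_intros) (auto simp: less_imp_neq[symmetric])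
  qed
  then have "(T \<longlongrightarrow> T ?a) (at_right ?a)"
    by (rule continuous_on_atLeast_at_right) simp
  then have Z_lim: "(Z \<longlongrightarrow> z) (at_right ?a)"
    unfolding Z_def z_def T_def[symmetric] by (intro tendsto_intros)
  have l_lim: "((\<lambda>a. l (a + r)) \<longlongrightarrow> l (?a + r)) (at_right ?a)"
  proof -
    have "continuous_on {0..} (\<lambda>a. l (a + r))"
      using r by (intro continuous_on_compose2[OF l_cont] continuous_intros) auto
    then show ?thesis by (rule continuous_on_atLeast_at_right) simp
  qed
  have above: "\<forall>\<^sub>F a in at_right ?a. ?a < a"
    by (simp add: eventually_at_right_less)
  have decr: "Z a \<in> X \<and> F (Z a) - v \<bullet> Z a \<le> F x - v \<bullet> x - r\<^sup>2 / (2 * l (a + r))"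
    if "?a < a" for a
    using descent_path.endpoint[OF dp[OF that]]
    by (simp add: Z_def T_def descent_path.p_def[OF dp[OF that]] descent_path.tau_def[OF dp[OF that]])
  \<comment> \<open>Converts the bound on \<open>F - v \<bullet> _\<close> into a uniform bound on
    \<open>F\<close> near the limit, which places \<open>z\<close> in \<open>X\<close>.\<close>
  have "\<forall>\<^sub>F a in at_right ?a. v \<bullet> Z a < v \<bullet> z + 1"
    by (rule order_tendstoD(2)[OF tendsto_inner[OF tendsto_const Z_lim]]) simp
  with above have "\<forall>\<^sub>F a in at_right ?a. Z a \<in> X \<and> F (Z a) \<le> F x - v \<bullet> x + v \<bullet> z + 1"
  proof eventually_elim
    case (elim a)
    have "0 < l (a + r)" using l_pos elim r norm_ge_zero[of "g x"] by (metis add_nonneg_nonneg less_eq_real_def order_trans)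
    then have "0 \<le> r\<^sup>2 / (2 * l (a + r))" by simp
    then show ?case using decr[OF elim(1)] elim(2) by auto
  qed
  then show z: "z \<in> X" using sublevel_limit(1)[OF Z_lim] by simp
  show "F z - v \<bullet> z \<le> F x - v \<bullet> x - r\<^sup>2 / (2 * l (?a + r))"
  proof (rule tendsto_le)
    show "((\<lambda>a. F (Z a) - v \<bullet> Z a) \<longlongrightarrow> F z - v \<bullet> z) (at_right ?a)"
      by (intro tendsto_intros Z_lim isCont_tendsto_compose[OF F_cont[OF z]])
    show "((\<lambda>a. F x - v \<bullet> x - r\<^sup>2 / (2 * l (a + r))) \<longlongrightarrow>
        F x - v \<bullet> x - r\<^sup>2 / (2 * l (?a + r))) (at_right ?a)"
      using l_pos[of "?a + r"] r by (intro tendsto_intros l_lim) auto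
    show "\<forall>\<^sub>F a in at_right ?a. F (Z a) - v \<bullet> Z a \<le> F x - v \<bullet> x - r\<^sup>2 / (2 * l (a + r))"
      using above by eventually_elim (use decr in auto)
  qed simp
qed

text \<open>\<open>generalized_descent\<close> with \<open>v = g y\<close> decreases
  \<open>F - g y \<bullet> _\<close> from \<open>x\<close>; by the tangent inequality this function
  is smallest at \<open>y\<close>, so its value at \<open>y\<close> is no larger than at the
  endpoint.\<close>

lemma cocoercive:
  assumes x: "x \<in> X" and y: "y \<in> X"
  shows "F y + g y \<bullet> (x - y) + (norm (g x - g y))\<^sup>2 / (2 * l (norm (g x) + norm (g x - g y))) \<le> F x"
proof (cases "g x = g y")
  case True
  then show ?thesis using tangent[OF y x] by simp
next
  case False
  let ?r = "norm (g x - g y)"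
  define e where "e = (1 / ?r) *\<^sub>R (g x - g y)"
  have e: "norm e = 1" "g x = g y + ?r *\<^sub>R e" using False by (auto simp: e_def)
  obtain z where z: "z \<in> X"
    "F z - g y \<bullet> z \<le> F x - g y \<bullet> x - ?r\<^sup>2 / (2 * l (norm (g x) + ?r))"
    using generalized_descent[OF x e norm_ge_zero] by blast
  show ?thesis using z(2) tangent[OF y z(1)] by (simp add: inner_diff_right)
qed

section \<open>Gradient descent\<close>

lemma gd_step_bounds:
  "1 / l (2 * norm w) \<le> gd_step l w" "gd_step l w \<le> 1 / l (norm w)"
proof -
  have int: "(\<lambda>\<sigma>. 1 / l (norm w + norm w * \<sigma>)) integrable_on {0..1}"
    by (intro integrable_continuous_interval inv_l_cont) auto
  have pt: "1 / l (2 * norm w) \<le> 1 / l (norm w + norm w * \<sigma>) \<and> 1 / l (norm w + norm w * \<sigma>) \<le> 1 / l (norm w)"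
    if "\<sigma> \<in> {0..1}" for \<sigma>
  proof -
    have "0 \<le> norm w * \<sigma>" "norm w * \<sigma> \<le> norm w"
      using that by (auto intro: mult_left_le)
    then show ?thesis by (auto intro!: divide_left_mono l_mono mult_pos_pos l_pos)
  qed
  have "integral {0..1} (\<lambda>_::real. 1 / l (2 * norm w)) \<le> gd_step l w"
    unfolding gd_step_def by (intro integral_le int) (use pt in auto)
  then show "1 / l (2 * norm w) \<le> gd_step l w" by simp
  have "gd_step l w \<le> integral {0..1} (\<lambda>_::real. 1 / l (norm w))"
    unfolding gd_step_def by (intro integral_le int) (use pt in auto)
  then show "gd_step l w \<le> 1 / l (norm w)" by simp
qed

lemma gd_step_nonneg: "0 \<le> gd_step l w"
  using gd_step_bounds(1)[of w] l_pos[of "2 * norm w"] by (simp add: order_trans[of 0 "1 / l (2 * norm w)"])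

text \<open>Rescaling the integration variable by \<open>norm (g x)\<close> identifies the gradient
  step with the endpoint in \<open>generalized_descent\<close> for \<open>v = 0\<close>.\<close>

lemma gd_descent:
  assumes x: "x \<in> X"
  shows "x - gd_step l (g x) *\<^sub>R g x \<in> X" "F (x - gd_step l (g x) *\<^sub>R g x) \<le> F x"
proof -
  let ?r = "norm (g x)"
  have "x - gd_step l (g x) *\<^sub>R g x \<in> X \<and> F (x - gd_step l (g x) *\<^sub>R g x) \<le> F x"
  proof (cases "g x = 0")
    case False
    define e where "e = (1 / ?r) *\<^sub>R g x"
    have e: "norm e = 1" "g x = 0 + ?r *\<^sub>R e" using False by (auto simp: e_def)
    have "((\<lambda>\<sigma>. 1 / l (?r + \<sigma>)) has_integral integral {0..?r} (\<lambda>\<sigma>. 1 / l (?r + \<sigma>))) (cbox 0 ?r)"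
      using inv_l_cont[of ?r 1 ?r]
      by (auto intro!: integrable_integral integrable_continuous_interval)
    from has_integral_affinity[OF this, of ?r 0] False
    have "((\<lambda>\<sigma>. 1 / l (?r + ?r * \<sigma>)) has_integral
        integral {0..?r} (\<lambda>\<sigma>. 1 / l (?r + \<sigma>)) / ?r) ((\<lambda>\<sigma>. \<sigma> / ?r) ` {0..?r})"
      by (simp add: divide_inverse mult.commute)
    moreover have "(\<lambda>\<sigma>. \<sigma> / ?r) ` {0..?r} = {0..1}"
      using False image_divide_atLeastAtMost[of ?r 0 ?r] by simp
    ultimately have "gd_step l (g x) = integral {0..?r} (\<lambda>\<sigma>. 1 / l (?r + \<sigma>)) / ?r"
      unfolding gd_step_def by (metis integral_unique)
    then have eq: "gd_step l (g x) *\<^sub>R g x = integral {0..?r} (\<lambda>\<sigma>. 1 / l (?r + \<sigma>)) *\<^sub>R e"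
      by (simp add: e_def)
    have "0 \<le> ?r\<^sup>2 / (2 * l (?r + ?r))" using l_pos[of "?r + ?r"] by simp
    then show ?thesis
      using generalized_descent[OF x e norm_ge_zero] unfolding eq by simp
  qed (use x in simp)
  then show "x - gd_step l (g x) *\<^sub>R g x \<in> X" "F (x - gd_step l (g x) *\<^sub>R g x) \<le> F x" by auto
qed

text \<open>Cocoercivity is applied from \<open>xs\<close> to \<open>x\<close>: as
  \<open>g xs = 0\<close>, its denominator involves \<open>l (norm (g x))\<close>. The bound of the
  step size by \<open>1 / l (norm (g x))\<close> then absorbs the quadratic term of the expanded
  square.\<close>

lemma gd_distance:
  assumes x: "x \<in> X" and xs: "xs \<in> X" "g xs = 0"
  shows "(norm (x - gd_step l (g x) *\<^sub>R g x - xs))\<^sup>2 \<le>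
    (norm (x - xs))\<^sup>2 - 2 * gd_step l (g x) * (F x - F xs)"
proof -
  let ?\<eta> = "gd_step l (g x)" and ?r = "norm (g x)"
  have "F x - F xs + ?r\<^sup>2 / (2 * l ?r) \<le> g x \<bullet> (x - xs)"
    using cocoercive[OF xs(1) x] xs(2) by (simp add: inner_diff_right)
  moreover have "?\<eta> * ?r\<^sup>2 \<le> (1 / l ?r) * ?r\<^sup>2"
    by (intro mult_right_mono gd_step_bounds) auto
  ultimately have "F x - F xs + ?\<eta> * ?r\<^sup>2 / 2 \<le> g x \<bullet> (x - xs)" by simp
  then have "?\<eta> * (F x - F xs + ?\<eta> * ?r\<^sup>2 / 2) \<le> ?\<eta> * (g x \<bullet> (x - xs))"
    by (rule mult_left_mono[OF _ gd_step_nonneg])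
  moreover have "(norm (x - ?\<eta> *\<^sub>R g x - xs))\<^sup>2 =
      (norm (x - xs))\<^sup>2 - 2 * (?\<eta> * (g x \<bullet> (x - xs))) + ?\<eta> * (?\<eta> * ?r\<^sup>2)"
    unfolding power2_norm_eq_inner
    by (simp add: inner_diff_left inner_diff_right inner_commute algebra_simps)
  ultimately show ?thesis by (simp add: algebra_simps)
qed

lemma gd_sequence:
  assumes xk: "xk 0 \<in> X" "\<And>j. xk (Suc j) = xk j - gd_step l (g (xk j)) *\<^sub>R g (xk j)"
    and xs: "xs \<in> X" "g xs = 0" and R: "norm (xk 0 - xs) \<le> R"
  shows "xk j \<in> X \<and> F (xk j) \<le> F (xk 0) \<and> norm (xk j - xs) \<le> R"
proof (induction j)
  case (Suc j)
  have "F xs \<le> F (xk j)" using tangent[OF xs(1), of "xk j"] xs(2) Suc by simp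
  then have "0 \<le> 2 * gd_step l (g (xk j)) * (F (xk j) - F xs)"
    by (intro mult_nonneg_nonneg gd_step_nonneg) auto
  moreover have "(norm (xk (Suc j) - xs))\<^sup>2 \<le>
      (norm (xk j - xs))\<^sup>2 - 2 * gd_step l (g (xk j)) * (F (xk j) - F xs)"
    unfolding xk(2) using Suc by (intro gd_distance xs) auto
  ultimately have "(norm (xk (Suc j) - xs))\<^sup>2 \<le> (norm (xk j - xs))\<^sup>2"
    by linarith
  then have "norm (xk (Suc j) - xs) \<le> norm (xk j - xs)"
    by (rule power2_le_imp_le) simp
  then show ?case using Suc gd_descent[of "xk j"] xk(2)[of j] by auto
qed (use assms in auto)

text \<open>With gradients bounded by \<open>M\<close> the step sizes are at least
  \<open>1 / l (2 * M)\<close>. A gap always above \<open>\<epsilon>\<close> would thus lower the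
  squared distance to \<open>xs\<close> by the fixed amount \<open>c\<close> in every step.\<close>

lemma gd_terminates:
  assumes xk: "xk 0 \<in> X" "\<And>j. xk (Suc j) = xk j - gd_step l (g (xk j)) *\<^sub>R g (xk j)"
    and xs: "xs \<in> X" "g xs = 0"
    and M: "\<And>j. norm (g (xk j)) \<le> M" and eps: "0 < \<epsilon>"
  shows "\<exists>j. F (xk j) - F xs \<le> \<epsilon>"
proof (rule ccontr)
  assume "\<nexists>j. F (xk j) - F xs \<le> \<epsilon>"
  then have far: "\<epsilon> < F (xk j) - F xs" for j by (meson not_less)
  have M0: "0 \<le> M" using M[of 0] norm_ge_zero order_trans by blast
  define c where "c = 2 * \<epsilon> / l (2 * M)"
  have c: "0 < c" using eps l_pos[of "2 * M"] M0 by (simp add: c_def)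
  have "(norm (xk n - xs))\<^sup>2 \<le> (norm (xk 0 - xs))\<^sup>2 - real n * c" for n
  proof (induction n)
    case (Suc n)
    have X: "xk n \<in> X" using gd_sequence[OF xk xs order_refl] by blast
    have "1 / l (2 * M) \<le> 1 / l (2 * norm (g (xk n)))"
      using M[of n] M0 by (intro divide_left_mono l_mono mult_pos_pos l_pos) auto
    then have "1 / l (2 * M) \<le> gd_step l (g (xk n))" using gd_step_bounds(1) order_trans by blast
    then have "1 / l (2 * M) * \<epsilon> \<le> gd_step l (g (xk n)) * (F (xk n) - F xs)"
      using far[of n] eps gd_step_nonneg by (intro mult_mono) auto
    then have "c \<le> 2 * gd_step l (g (xk n)) * (F (xk n) - F xs)" by (simp add: c_def)
    moreover have "(norm (xk (Suc n) - xs))\<^sup>2 \<le>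
        (norm (xk n - xs))\<^sup>2 - 2 * gd_step l (g (xk n)) * (F (xk n) - F xs)"
      unfolding xk(2) by (rule gd_distance[OF X xs])
    moreover have "real (Suc n) * c = real n * c + c" by (simp add: algebra_simps)
    ultimately show ?case using Suc by linarith
  qed simp
  moreover obtain n where "(norm (xk 0 - xs))\<^sup>2 < real n * c"
    using reals_Archimedean3[OF c] by blast
  ultimately show False
    by (smt (verit) zero_le_power2)
qed

section \<open>The accelerated step\<close>

lemma gradient_minimizer:
  assumes xs: "xs \<in> X" and min: "\<And>z. z \<in> X \<Longrightarrow> F xs \<le> F z"
  shows "g xs = 0"
proof -
  have "(\<lambda>h. h \<bullet> g xs) = (\<lambda>h. 0)"
    using differential_zero_maxmin[OF xs open_X F_deriv[OF xs]] min by blast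
  then show ?thesis by (metis inner_eq_zero_iff)
qed

lemma gradient_gap:
  assumes "x \<in> X" "xs \<in> X" "g xs = 0"
  shows "(norm (g x))\<^sup>2 / (2 * l (2 * norm (g x))) \<le> F x - F xs"
  using cocoercive[OF assms(1,2)] assms(3) by simp

text \<open>Adds cocoercivity between \<open>y\<close> and \<open>q\<close> to \<open>c\<close>
  times the tangent inequality from \<open>q\<close> to \<open>xs\<close>, and eliminates
  \<open>q\<close> from the inner products by \<open>eq\<close>. The argument of \<open>l\<close> is
  at most \<open>D + (D + 2 * D) = 4 * D\<close>. Independent weights \<open>c\<close> and
  \<open>d\<close> cover both the full step and the intermediate points of
  \<open>acc_path\<close>.\<close>

lemma acc_inequality:
  assumes y: "y \<in> X" "norm (g y) \<le> D" and q: "q \<in> X" "norm (g q) \<le> 2 * D" and xs: "xs \<in> X"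
    and D: "0 \<le> D" "l (4 * D) \<le> 1 / \<gamma>" and \<gamma>: "0 < \<gamma>" and c: "0 \<le> c"
    and eq: "(1 + c) *\<^sub>R q = y + c *\<^sub>R u - d *\<^sub>R g y"
  shows "(1 + c) * (F q - F xs) \<le>
    F y - F xs + c * (g q \<bullet> (u - xs)) - d * (g q \<bullet> g y) - \<gamma> / 2 * (norm (g y - g q))\<^sup>2"
proof -
  let ?r = "norm (g y - g q)"
  have "norm (g y) + ?r \<le> 4 * D"
    using norm_triangle_ineq4[of "g y" "g q"] y q by linarith
  then have "l (norm (g y) + ?r) \<le> 1 / \<gamma>"
    using D(2) by (auto intro: order_trans[OF l_mono])
  then have "\<gamma> * l (norm (g y) + ?r) \<le> 1"
    using \<gamma> by (simp add: pos_le_divide_eq mult.commute)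
  moreover have lp: "0 < l (norm (g y) + ?r)" by (intro l_pos) auto
  ultimately have "\<gamma> \<le> 1 / l (norm (g y) + ?r)"
    by (simp add: pos_le_divide_eq)
  then have "\<gamma> * (?r\<^sup>2 / 2) \<le> 1 / l (norm (g y) + ?r) * (?r\<^sup>2 / 2)"
    by (rule mult_right_mono) simp
  then have 1: "F q + g q \<bullet> (y - q) + \<gamma> / 2 * ?r\<^sup>2 \<le> F y"
    using cocoercive[OF y(1) q(1)] by simp
  have 2: "c * (F q + g q \<bullet> (xs - q)) \<le> c * F xs"
    using tangent[OF q(1) xs] c by (rule mult_left_mono)
  have "g q \<bullet> ((1 + c) *\<^sub>R q) = g q \<bullet> (y + c *\<^sub>R u - d *\<^sub>R g y)" by (simp only: eq)
  then have "(1 + c) * (g q \<bullet> q) = g q \<bullet> y + c * (g q \<bullet> u) - d * (g q \<bullet> g y)"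
    by (simp add: inner_add_right inner_diff_right)
  with 1 2 show ?thesis by (simp add: inner_diff_right algebra_simps)
qed

text \<open>The point \<open>y'\<close> is joined to \<open>y\<close> by the points that the same step yields for the smaller
  weights \<open>c \<in> [0,\<alpha>]\<close>. As long as the gradient along this path is below \<open>2 D\<close>, the step
  inequality bounds the function gap by \<open>\<delta>\<close>, which in turn brings the gradient back below \<open>D\<close>.\<close>
lemma acc_path:
  assumes y: "y \<in> X" "norm (g y) \<le> D" and xs: "xs \<in> X"
    and min: "\<And>z. z \<in> X \<Longrightarrow> F xs \<le> F z"
    and D: "0 < D" "l (4 * D) \<le> 1 / \<gamma>" and pos: "0 < \<gamma>" "0 < \<Gamma>" "0 < \<alpha>" and \<alpha>: "\<alpha>\<^sup>2 = \<gamma> * \<Gamma>"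
    and pot: "F y - F xs + \<Gamma> / 2 * (norm (u - xs))\<^sup>2 \<le> \<delta>"
    and b: "D < b" "\<And>z. z \<in> X \<Longrightarrow> F z - F xs \<le> \<delta> \<Longrightarrow> norm (g z) < b \<Longrightarrow> norm (g z) \<le> D"
    and eq: "(1 + \<alpha>) *\<^sub>R y' = y + \<alpha> *\<^sub>R u - \<gamma> *\<^sub>R g y"
  shows "y' \<in> X \<and> F y' - F xs \<le> \<delta> \<and> norm (g y') \<le> D"
proof -
  \<comment> \<open>The gradient weight is scaled linearly in \<open>c\<close>, so that
    \<open>p 0 = y\<close> and \<open>p \<alpha> = y'\<close>.\<close>
  define p where "p c = (1 / (1 + c)) *\<^sub>R (y + c *\<^sub>R u - (c * (\<gamma> / \<alpha>)) *\<^sub>R g y)" for c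
  have p0: "p 0 = y" by (simp add: p_def)
  have p\<alpha>: "p \<alpha> = y'"
  proof -
    have "\<alpha> * (\<gamma> / \<alpha>) = \<gamma>" using pos by simp
    then have "p \<alpha> = (1 / (1 + \<alpha>)) *\<^sub>R ((1 + \<alpha>) *\<^sub>R y')" unfolding p_def eq by simp
    then show ?thesis using pos by simp
  qed
  have p_eq: "(1 + c) *\<^sub>R p c = y + c *\<^sub>R u - (c * (\<gamma> / \<alpha>)) *\<^sub>R g y" if "0 \<le> c" for c
    using that by (simp add: p_def)
  have p_cont: "isCont p c" if "0 \<le> c" for c
    unfolding p_def using that by (intro continuous_intros) auto
  have gap: "F (p c) - F xs \<le> \<delta>"
    if c: "0 \<le> c" "c \<le> \<alpha>" and "p c \<in> X" "norm (g (p c)) \<le> 2 * D" for c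
  proof -
    define d where "d = c * (\<gamma> / \<alpha>)"
    \<comment> \<open>The last inequality is what Young's inequality needs to split
      \<open>c * (?q \<bullet> (u - xs))\<close>; \<open>d \<le> \<gamma>\<close> lets the
      cocoercivity term absorb the remainder.\<close>
    have d: "0 \<le> d" "d \<le> \<gamma>" "c\<^sup>2 \<le> d * \<Gamma>"
    proof -
      show "0 \<le> d" using c pos by (simp add: d_def)
      show "d \<le> \<gamma>" using c pos by (simp add: d_def pos_divide_le_eq mult.commute)
      have "d * \<Gamma> = c * (\<gamma> * \<Gamma> / \<alpha>)" by (simp add: d_def)
      also have "\<dots> = c * \<alpha>" using pos by (simp add: \<alpha>[symmetric] power2_eq_square)
      finally show "c\<^sup>2 \<le> d * \<Gamma>" using c by (simp add: power2_eq_square mult_left_mono)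
    qed
    let ?q = "g (p c)"
    have "(1 + c) * (F (p c) - F xs) \<le>
        F y - F xs + c * (?q \<bullet> (u - xs)) - d * (?q \<bullet> g y) - \<gamma> / 2 * (norm (g y - ?q))\<^sup>2"
      unfolding d_def
      by (rule acc_inequality[OF y that(3,4) xs less_imp_le[OF D(1)] D(2) pos(1) c(1) p_eq[OF c(1)]])
    moreover have "c * (?q \<bullet> (u - xs)) \<le> d / 2 * (norm ?q)\<^sup>2 + \<Gamma> / 2 * (norm (u - xs))\<^sup>2"
    proof -
      have "0 \<le> (norm (c *\<^sub>R ?q - \<Gamma> *\<^sub>R (u - xs)))\<^sup>2" by simp
      also have "\<dots> = c\<^sup>2 * (norm ?q)\<^sup>2 - 2 * \<Gamma> * (c * (?q \<bullet> (u - xs))) + \<Gamma>\<^sup>2 * (norm (u - xs))\<^sup>2"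
        unfolding power2_norm_eq_inner
        by (simp add: inner_diff_left inner_diff_right inner_commute algebra_simps power2_eq_square)
      also have "\<dots> \<le> d * \<Gamma> * (norm ?q)\<^sup>2 - 2 * \<Gamma> * (c * (?q \<bullet> (u - xs))) + \<Gamma>\<^sup>2 * (norm (u - xs))\<^sup>2"
        using d(3) by (simp add: mult_right_mono)
      also have "\<dots> = 2 * \<Gamma> * (d / 2 * (norm ?q)\<^sup>2 + \<Gamma> / 2 * (norm (u - xs))\<^sup>2 - c * (?q \<bullet> (u - xs)))"
        by (simp add: algebra_simps power2_eq_square)
      finally have "0 \<le> d / 2 * (norm ?q)\<^sup>2 + \<Gamma> / 2 * (norm (u - xs))\<^sup>2 - c * (?q \<bullet> (u - xs))"
        using pos by (simp add: zero_le_mult_iff)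
      then show ?thesis by simp
    qed
    moreover have "d / 2 * (norm ?q)\<^sup>2 - d * (?q \<bullet> g y) \<le> d / 2 * (norm (g y - ?q))\<^sup>2"
    proof -
      have eq: "(norm (g y - ?q))\<^sup>2 = (norm (g y))\<^sup>2 - 2 * (?q \<bullet> g y) + (norm ?q)\<^sup>2"
        unfolding power2_norm_eq_inner
        by (simp add: inner_diff_left inner_diff_right inner_commute)
      have "0 \<le> d / 2 * (norm (g y))\<^sup>2" using d by simp
      then show ?thesis unfolding eq by (simp add: algebra_simps)
    qed
    moreover have "d / 2 * (norm (g y - ?q))\<^sup>2 \<le> \<gamma> / 2 * (norm (g y - ?q))\<^sup>2"
      using d by (intro mult_right_mono) auto
    ultimately have "(1 + c) * (F (p c) - F xs) \<le> \<delta>" using pot by linarith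
    moreover have "0 \<le> c * (F (p c) - F xs)" using c min[OF that(3)] by simp
    ultimately show ?thesis by (simp add: algebra_simps)
  qed
  have gap_y: "F y - F xs \<le> \<delta>"
    using gap[of 0] p0 y pos D by simp
  have "p \<alpha> \<in> X \<and> F (p \<alpha>) - F xs \<le> \<delta> \<and> norm (g (p \<alpha>)) \<le> D"
  proof (rule real_continuation[where a = 0 and b = \<alpha> and
        P = "\<lambda>c. p c \<in> X \<and> F (p c) - F xs \<le> \<delta> \<and> norm (g (p c)) \<le> D"])
    fix t assume t: "0 < t" "t \<le> \<alpha>"
      and good: "\<And>s. 0 \<le> s \<Longrightarrow> s < t \<Longrightarrow> p s \<in> X \<and> F (p s) - F xs \<le> \<delta> \<and> norm (g (p s)) \<le> D"
    have lim: "(p \<longlongrightarrow> p t) (at_left t)"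
      using filterlim_at_split[of p "nhds (p t)" t] p_cont[of t] t by (auto simp: isCont_def)
    have ev: "\<forall>\<^sub>F s in at_left t. p s \<in> X \<and> F (p s) - F xs \<le> \<delta> \<and> norm (g (p s)) \<le> D"
      using eventually_at_left[OF t(1)] good t by (auto intro!: exI[of _ 0])
    then have "\<forall>\<^sub>F s in at_left t. p s \<in> X \<and> F (p s) \<le> \<delta> + F xs"
      by eventually_elim auto
    note pt = sublevel_limit[OF lim _ this]
    have "((\<lambda>s. norm (g (p s))) \<longlongrightarrow> norm (g (p t))) (at_left t)"
      using pt by (intro tendsto_intros isCont_tendsto_compose[OF g_cont] lim) auto
    then have "norm (g (p t)) \<le> D"
      by (rule tendsto_upperbound) (use ev in \<open>auto elim: eventually_mono\<close>)
    then show "p t \<in> X \<and> F (p t) - F xs \<le> \<delta> \<and> norm (g (p t)) \<le> D" using pt by auto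
  next
    fix t assume t: "0 \<le> t" "t < \<alpha>" and Pt: "p t \<in> X \<and> F (p t) - F xs \<le> \<delta> \<and> norm (g (p t)) \<le> D"
    have lim: "(p \<longlongrightarrow> p t) (at_right t)"
      using filterlim_at_split[of p "nhds (p t)" t] p_cont[of t] t by (auto simp: isCont_def)
    have "\<forall>\<^sub>F s in at_right t. p s \<in> X"
      using topological_tendstoD[OF lim open_X] Pt by auto
    \<comment> \<open>Both caps lie strictly above \<open>D\<close>. Below \<open>2 * D\<close> the
      estimate \<open>gap\<close> applies, and below \<open>b\<close> the second part of hypothesis
      \<open>b\<close> pulls the gradient back to \<open>D\<close>.\<close>
    moreover have "\<forall>\<^sub>F s in at_right t. norm (g (p s)) < min b (2 * D)"
    proof (rule order_tendstoD(2))
      show "((\<lambda>s. norm (g (p s))) \<longlongrightarrow> norm (g (p t))) (at_right t)"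
        using Pt by (intro tendsto_intros isCont_tendsto_compose[OF g_cont] lim) auto
    qed (use Pt b D in auto)
    moreover have "\<forall>\<^sub>F s in at_right t. s \<in> {t<..<\<alpha>}"
      by (rule eventually_at_right_real[OF t(2)])
    ultimately show "\<forall>\<^sub>F s in at_right t. p s \<in> X \<and> F (p s) - F xs \<le> \<delta> \<and> norm (g (p s)) \<le> D"
    proof eventually_elim
      case (elim s)
      then have "F (p s) - F xs \<le> \<delta>" using t by (intro gap) auto
      then show ?case using elim b(2)[of "p s"] by auto
    qed
  qed (use pos p0 y gap_y in auto)
  then show ?thesis by (simp add: p\<alpha>)
qed

text \<open>The inner product with \<open>u - xs\<close> is split at \<open>u'\<close>: Young's
  inequality handles \<open>u - u'\<close>, the projection inequality and the three-point identity
  handle \<open>u' - xs\<close>. Because \<open>\<alpha>\<^sup>2 = \<gamma> * \<Gamma>\<close>, the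
  term in \<open>norm (g y')\<close> cancels against the cocoercivity term.\<close>

lemma acc_potential:
  assumes y: "y \<in> X" "norm (g y) \<le> D" and y': "y' \<in> X" "norm (g y') \<le> D" and xs: "xs \<in> X"
    and D: "0 < D" "l (4 * D) \<le> 1 / \<gamma>" and pos: "0 < \<gamma>" "0 < \<Gamma>" "0 < \<alpha>" and \<alpha>: "\<alpha>\<^sup>2 = \<gamma> * \<Gamma>"
    and eq: "(1 + \<alpha>) *\<^sub>R y' = y + \<alpha> *\<^sub>R u - \<gamma> *\<^sub>R g y"
    and proj: "(u - (\<alpha> / \<Gamma>) *\<^sub>R g y' - u') \<bullet> (xs - u') \<le> 0"
  shows "(1 + \<alpha>) * (F y' - F xs) + \<Gamma> / 2 * (norm (u' - xs))\<^sup>2 \<le>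
    F y - F xs + \<Gamma> / 2 * (norm (u - xs))\<^sup>2"
proof -
  have 1: "(1 + \<alpha>) * (F y' - F xs) \<le>
      F y - F xs + \<alpha> * (g y' \<bullet> (u - xs)) - \<gamma> * (g y' \<bullet> g y) - \<gamma> / 2 * (norm (g y - g y'))\<^sup>2"
    using y' D pos by (intro acc_inequality[OF y _ _ xs _ _ _ _ eq]) auto
  have 2: "\<alpha> * (g y' \<bullet> (u - u')) \<le> \<gamma> / 2 * (norm (g y'))\<^sup>2 + \<Gamma> / 2 * (norm (u - u'))\<^sup>2"
  proof -
    have "0 \<le> (norm (\<alpha> *\<^sub>R g y' - \<Gamma> *\<^sub>R (u - u')))\<^sup>2" by simp
    also have "\<dots> = \<alpha>\<^sup>2 * (norm (g y'))\<^sup>2 - 2 * \<Gamma> * (\<alpha> * (g y' \<bullet> (u - u'))) + \<Gamma>\<^sup>2 * (norm (u - u'))\<^sup>2"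
      unfolding power2_norm_eq_inner
      by (simp add: inner_diff_left inner_diff_right inner_commute algebra_simps power2_eq_square)
    also have "\<dots> = 2 * \<Gamma> * (\<gamma> / 2 * (norm (g y'))\<^sup>2 + \<Gamma> / 2 * (norm (u - u'))\<^sup>2 - \<alpha> * (g y' \<bullet> (u - u')))"
      unfolding \<alpha> by (simp add: algebra_simps power2_eq_square)
    finally have "0 \<le> \<gamma> / 2 * (norm (g y'))\<^sup>2 + \<Gamma> / 2 * (norm (u - u'))\<^sup>2 - \<alpha> * (g y' \<bullet> (u - u'))"
      using pos by (simp add: zero_le_mult_iff)
    then show ?thesis by simp
  qed
  have 3: "\<alpha> * (g y' \<bullet> (u' - xs)) \<le>
      \<Gamma> / 2 * (norm (u - xs))\<^sup>2 - \<Gamma> / 2 * (norm (u' - xs))\<^sup>2 - \<Gamma> / 2 * (norm (u - u'))\<^sup>2"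
  proof -
    have "\<alpha> / \<Gamma> * (g y' \<bullet> (u' - xs)) \<le> (u - u') \<bullet> (u' - xs)"
      using proj by (simp add: inner_diff_left inner_diff_right algebra_simps)
    then have "\<Gamma> * (\<alpha> / \<Gamma> * (g y' \<bullet> (u' - xs))) \<le> \<Gamma> * ((u - u') \<bullet> (u' - xs))"
      using pos by (intro mult_left_mono) auto
    moreover have "\<Gamma> * (\<alpha> / \<Gamma> * (g y' \<bullet> (u' - xs))) = \<alpha> * (g y' \<bullet> (u' - xs))"
      using pos by simp
    moreover have "(u - u') \<bullet> (u' - xs) =
        ((norm (u - xs))\<^sup>2 - (norm (u' - xs))\<^sup>2 - (norm (u - u'))\<^sup>2) / 2"
      unfolding power2_norm_eq_inner
      by (simp add: inner_diff_left inner_diff_right inner_commute)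
    ultimately show ?thesis by (simp add: right_diff_distrib diff_divide_distrib)
  qed
  have 4: "(norm (g y - g y'))\<^sup>2 = (norm (g y))\<^sup>2 - 2 * (g y' \<bullet> g y) + (norm (g y'))\<^sup>2"
    unfolding power2_norm_eq_inner
    by (simp add: inner_diff_left inner_diff_right inner_commute)
  have "\<gamma> / 2 * (norm (g y'))\<^sup>2 - \<gamma> * (g y' \<bullet> g y) - \<gamma> / 2 * (norm (g y - g y'))\<^sup>2 = - \<gamma> / 2 * (norm (g y))\<^sup>2"
    unfolding 4 by (simp add: algebra_simps)
  moreover have "- \<gamma> / 2 * (norm (g y))\<^sup>2 \<le> 0" using pos by simp
  moreover have "\<alpha> * (g y' \<bullet> (u - xs)) = \<alpha> * (g y' \<bullet> (u - u')) + \<alpha> * (g y' \<bullet> (u' - xs))"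
    by (simp add: inner_diff_right algebra_simps)
  ultimately show ?thesis using 1 2 3 by linarith
qed

end

section \<open>Decay of the step parameters\<close>

text \<open>After squaring, the claim reads \<open>1 + 2 * a / 3 + a * a / 9 \<le> 1 + a\<close>,
  which follows from \<open>a * a \<le> 2 * a\<close>.\<close>

lemma inverse_step_growth:
  fixes a b :: real
  assumes "0 < a" "a \<le> 2" "0 < b" "b\<^sup>2 = a\<^sup>2 / (1 + a)"
  shows "1 / a + 1 / 3 \<le> 1 / b"
proof (rule power2_le_imp_le)
  have "a * a \<le> 2 * a" using assms by (intro mult_right_mono) auto
  then have le: "1 + 2 * a / 3 + a * a / 9 \<le> 1 + a" using assms(1) by linarith
  have "(1 / a + 1 / 3)\<^sup>2 = (1 + 2 * a / 3 + a * a / 9) / a\<^sup>2"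
    using assms by (simp add: power2_eq_square field_simps)
  also have "\<dots> \<le> (1 + a) / a\<^sup>2"
    by (rule divide_right_mono[OF le]) simp
  also have "\<dots> = (1 / b)\<^sup>2" using assms by (simp add: power_divide)
  finally show "(1 / a + 1 / 3)\<^sup>2 \<le> (1 / b)\<^sup>2" .
qed (use assms in simp)

lemma step_size_rate:
  fixes \<alpha> :: "nat \<Rightarrow> real"
  assumes pos: "\<And>k. 0 < \<alpha> k" and rec: "\<And>k. (\<alpha> (Suc k))\<^sup>2 = (\<alpha> k)\<^sup>2 / (1 + \<alpha> k)"
  defines "kb \<equiv> max (1 + 1/2 * log (3/2) ((\<alpha> 0)\<^sup>2 / 4)) 0"
  assumes k: "kb \<le> real k"
  shows "\<alpha> (Suc k) \<le> 3 / (real (Suc k) - kb)"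
proof -
  \<comment> \<open>While \<open>\<alpha> > 2\<close>, the square of \<open>\<alpha>\<close> shrinks by a factor of at least \<open>3 \<ge> (3/2)\<^sup>2\<close> per step;
    afterwards \<open>1 / \<alpha>\<close> grows by at least \<open>1/3\<close> per step.\<close>
  have warmup: "real (Suc n) \<le> kb" if "2 < \<alpha> n" "3 ^ n * (\<alpha> n)\<^sup>2 \<le> (\<alpha> 0)\<^sup>2" for n
  proof -
    have "(2::real)\<^sup>2 \<le> (\<alpha> n)\<^sup>2" using that by (intro power_mono) auto
    then have "3 ^ n * 4 \<le> 3 ^ n * (\<alpha> n)\<^sup>2" by simp
    moreover have "(3/2) ^ (2 * n) \<le> (3::real) ^ n"
      unfolding power_mult by (intro power_mono) (auto simp: power2_eq_square)
    ultimately have "(3/2) ^ (2 * n) \<le> (\<alpha> 0)\<^sup>2 / 4" using that(2) by linarith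
    then have "real (2 * n) \<le> log (3/2) ((\<alpha> 0)\<^sup>2 / 4)" by (intro le_log_of_power) auto
    then show ?thesis by (simp add: kb_def)
  qed
  \<comment> \<open>The second alternative is vacuous while \<open>real n \<le> kb\<close>. At the
    switch from the first one, \<open>warmup\<close> gives \<open>real (Suc n) \<le> kb\<close>, for
    which the summand 1 in \<open>kb\<close> provides.\<close>
  have inv: "2 < \<alpha> n \<and> 3 ^ n * (\<alpha> n)\<^sup>2 \<le> (\<alpha> 0)\<^sup>2 \<or>
      \<alpha> n \<le> 2 \<and> (real n - kb) / 3 \<le> 1 / \<alpha> n" for n
  proof (induction n)
    case 0
    have "0 \<le> 1 / \<alpha> 0" "0 \<le> kb" using pos[of 0] by (auto simp: kb_def)
    moreover have "(real 0 - kb) / 3 \<le> 0" using \<open>0 \<le> kb\<close> by simp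
    ultimately have "(real 0 - kb) / 3 \<le> 1 / \<alpha> 0" by linarith
    then show ?case by auto
  next
    case (Suc n)
    show ?case
    proof (cases "2 < \<alpha> n")
      case True
      have "(\<alpha> (Suc n))\<^sup>2 \<le> (\<alpha> n)\<^sup>2 / 3"
        unfolding rec using True by (intro divide_left_mono) auto
      then have "3 ^ Suc n * (\<alpha> (Suc n))\<^sup>2 \<le> 3 ^ Suc n * ((\<alpha> n)\<^sup>2 / 3)"
        by (rule mult_left_mono) simp
      also have "\<dots> = 3 ^ n * (\<alpha> n)\<^sup>2" by simp
      also have "\<dots> \<le> (\<alpha> 0)\<^sup>2" using True Suc by simp
      finally have le: "3 ^ Suc n * (\<alpha> (Suc n))\<^sup>2 \<le> (\<alpha> 0)\<^sup>2" .
      have "(real (Suc n) - kb) / 3 \<le> 0" using warmup[of n] True Suc by auto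
      moreover have "0 \<le> 1 / \<alpha> (Suc n)" using pos[of "Suc n"] by simp
      ultimately have "(real (Suc n) - kb) / 3 \<le> 1 / \<alpha> (Suc n)" by linarith
      then show ?thesis using le by linarith
    next
      case False
      have "(\<alpha> (Suc n))\<^sup>2 \<le> (\<alpha> n)\<^sup>2 / 1"
        unfolding rec using pos[of n] by (intro divide_left_mono) auto
      then have "(\<alpha> (Suc n))\<^sup>2 \<le> (\<alpha> n)\<^sup>2" by simp
      then have "\<alpha> (Suc n) \<le> \<alpha> n"
        by (rule power2_le_imp_le) (use pos[of n] in simp)
      then have le2: "\<alpha> (Suc n) \<le> 2" using False by simp
      have "1 / \<alpha> n + 1 / 3 \<le> 1 / \<alpha> (Suc n)"
        using False pos rec by (intro inverse_step_growth) auto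
      moreover have "(real (Suc n) - kb) / 3 = (real n - kb) / 3 + 1 / 3" by simp
      ultimately show ?thesis using Suc False le2 by linarith
    qed
  qed
  have "\<not> (2 < \<alpha> (Suc k) \<and> 3 ^ Suc k * (\<alpha> (Suc k))\<^sup>2 \<le> (\<alpha> 0)\<^sup>2)"
    using warmup[of "Suc k"] k by auto
  then have "(real (Suc k) - kb) / 3 \<le> 1 / \<alpha> (Suc k)" using inv[of "Suc k"] by blast
  moreover have "0 < real (Suc k) - kb" using k by simp
  ultimately show ?thesis using pos[of "Suc k"] by (simp add: field_simps)
qed

lemma acc_Gamma_pos:
  assumes "0 < \<delta>" "0 < R" "0 < l 0"
  shows "0 < acc_Gamma l \<delta> R k"
proof (induction k)
  case (Suc k)
  have "0 \<le> sqrt (acc_gamma l * acc_Gamma l \<delta> R k)"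
    using Suc assms by (simp add: acc_gamma_def)
  then have "0 < 1 + sqrt (acc_gamma l * acc_Gamma l \<delta> R k)" by linarith
  then show ?case using Suc by simp
qed (use assms in simp)

text \<open>As \<open>\<Gamma>\<^sub>k = 2 * l 0 * \<alpha>\<^sub>k\<^sup>2\<close>, both sequences
  obey the same recursion, so \<open>step_size_rate\<close> applies and the constant is
  \<open>3\<^sup>2 * 2 = 18\<close>.\<close>

lemma acc_Gamma_rate:
  assumes pos: "0 < \<delta>" "0 < R" "0 < l 0" and k: "k_bar l \<delta> R \<le> real k"
  shows "acc_Gamma l \<delta> R (Suc k) \<le> 18 * l 0 / (real (Suc k) - k_bar l \<delta> R)\<^sup>2"
proof -
  let ?G = "acc_Gamma l \<delta> R" and ?a = "acc_alpha l \<delta> R"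
  have G: "0 < ?G n" for n using acc_Gamma_pos pos by blast
  have a: "0 < ?a n" "(?a n)\<^sup>2 = ?G n / (2 * l 0)" for n
    using G[of n] pos by (auto simp: acc_alpha_def acc_gamma_def)
  have rec: "(?a (Suc n))\<^sup>2 = (?a n)\<^sup>2 / (1 + ?a n)" for n
    unfolding a(2) acc_Gamma.simps acc_alpha_def[symmetric] by simp
  have kb: "k_bar l \<delta> R = max (1 + 1/2 * log (3/2) ((?a 0)\<^sup>2 / 4)) 0"
  proof -
    have "?G 0 / (8 * l 0) = ?G 0 / (2 * l 0) / 4" by simp
    then show ?thesis using G[of 0] unfolding a(2) k_bar_def by (simp del: acc_Gamma.simps)
  qed
  have "?a (Suc k) \<le> 3 / (real (Suc k) - k_bar l \<delta> R)"
    using step_size_rate[of ?a, OF a(1) rec, of k] k unfolding kb by simp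
  then have "(?a (Suc k))\<^sup>2 \<le> (3 / (real (Suc k) - k_bar l \<delta> R))\<^sup>2"
    using a(1)[of "Suc k"] by (intro power_mono) auto
  then have "?G (Suc k) / (2 * l 0) \<le> 9 / (real (Suc k) - k_bar l \<delta> R)\<^sup>2"
    unfolding a(2) by (simp add: power_divide)
  then have "?G (Suc k) / (2 * l 0) * (2 * l 0) \<le> 9 / (real (Suc k) - k_bar l \<delta> R)\<^sup>2 * (2 * l 0)"
    using pos by (intro mult_right_mono) auto
  then show ?thesis using pos by simp
qed

section \<open>The function \<open>\<psi>\<close>\<close>

locale growth_bound =
  fixes l :: "real \<Rightarrow> real"
  assumes mono: "mono_on {0..} l"
    and pos: "0 \<le> s \<Longrightarrow> 0 < l s"
    and lip: "0 \<le> s \<Longrightarrow> \<exists>e>0. \<exists>L. L-lipschitz_on (cball s e \<inter> {0..}) l"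
begin

lemma cont: "continuous_on {0..} l"
  unfolding continuous_on_eq_continuous_within
proof
  fix s :: real assume s: "s \<in> {0..}"
  then obtain e L where e: "0 < e" "L-lipschitz_on (cball s e \<inter> {0..}) l" using lip[of s] by auto
  have "continuous (at s within (cball s e \<inter> {0..})) l"
    using lipschitz_on_continuous_on[OF e(2)] s e(1) by (auto simp: continuous_on_eq_continuous_within)
  moreover have "at s within (cball s e \<inter> {0..}) = at s within {0..}"
    by (rule at_within_nhd[of _ "ball s e"]) (use e in auto)
  ultimately show "continuous (at s within {0..}) l" by (simp add: continuous_within)
qed

lemma psi_cont: "continuous_on {0..} (psi l)"
proof -
  have "continuous_on {0..} (\<lambda>x. l (4 * x))"
    by (intro continuous_on_compose2[OF cont] continuous_intros) auto
  then show ?thesis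
    unfolding psi_def[abs_def] using pos
    by (intro continuous_intros) (auto simp: less_imp_neq[symmetric])
qed

text \<open>Cross-multiplied, the claim is
  \<open>x\<^sup>2 * l (4 * y) < y\<^sup>2 * l (4 * x)\<close>. The Lipschitz growth of
  \<open>l\<close> costs at most \<open>(y - x) * x * l 0\<close> on the left, less than the gain
  from \<open>y\<^sup>2 - x\<^sup>2\<close> on the right.\<close>

lemma psi_strict_mono_near_0: "\<exists>D>0. strict_mono_on {x. 0 \<le> x \<and> x < D} (psi l)"
proof -
  obtain e L where e: "0 < e" "L-lipschitz_on (cball 0 e \<inter> {0..}) l" using lip[of 0] by auto
  have L: "0 \<le> L" using lipschitz_on_nonneg[OF e(2)] .
  \<comment> \<open>The first bound keeps \<open>4 * y\<close> in the Lipschitz neighbourhood, the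
    second gives \<open>4 * L * x \<le> l 0\<close>; adding 1 avoids division by zero.\<close>
  define D where "D = min (e / 4) (l 0 / (4 * L + 1))"
  have "0 < D" using e L pos[of 0] by (simp add: D_def)
  moreover have "psi l x < psi l y" if x: "0 \<le> x" and xy: "x < y" and y: "y < D" for x y
  proof -
    have "dist (l (4 * y)) (l (4 * x)) \<le> L * dist (4 * y) (4 * x)"
      using x xy y by (intro lipschitz_onD[OF e(2)]) (auto simp: D_def)
    also have "L * dist (4 * y) (4 * x) = 4 * L * (y - x)"
      using xy by (simp add: dist_real_def right_diff_distrib)
    finally have "l (4 * y) \<le> l (4 * x) + 4 * L * (y - x)"
      by (simp add: dist_real_def abs_le_iff)
    then have "x\<^sup>2 * l (4 * y) \<le> x\<^sup>2 * (l (4 * x) + 4 * L * (y - x))"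
      by (rule mult_left_mono) simp
    also have "\<dots> = x\<^sup>2 * l (4 * x) + (y - x) * x * (4 * L * x)"
      by (simp add: algebra_simps power2_eq_square)
    also have "4 * L * x \<le> l 0"
    proof -
      have "x \<le> l 0 / (4 * L + 1)" using xy y by (simp add: D_def)
      then have "x * (4 * L + 1) \<le> l 0" using L by (simp add: pos_le_divide_eq)
      then show ?thesis using x by (simp add: algebra_simps)
    qed
    then have "(y - x) * x * (4 * L * x) \<le> (y - x) * x * l 0"
      using x xy by (intro mult_left_mono) auto
    also have "l 0 \<le> l (4 * x)" using x by (intro mono_onD[OF mono]) auto
    then have "(y - x) * x * l 0 \<le> (y - x) * x * l (4 * x)"
      using x xy by (intro mult_left_mono) auto
    also have "\<dots> < (y - x) * (y + x) * l (4 * x)"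
      using x xy pos[of "4 * x"] by (intro mult_strict_right_mono mult_strict_left_mono) auto
    finally have "x\<^sup>2 * l (4 * y) < y\<^sup>2 * l (4 * x)"
      by (simp add: algebra_simps power2_eq_square)
    then show ?thesis
      using pos[of "4 * x"] pos[of "4 * y"] x xy by (simp add: psi_def field_simps)
  qed
  ultimately show ?thesis by (intro exI[of _ D]) (auto simp: strict_mono_on_def)
qed

text \<open>Justifies the \<open>GREATEST\<close> in the definition: the admissible bounds are
  nonempty and contain their supremum, since any point below the supremum lies below some admissible
  bound.\<close>

lemma Delta_max:
  "0 < Delta_max l" "strict_mono_on {x. 0 \<le> x \<and> ereal x < Delta_max l} (psi l)"
proof -
  define S where "S = {D. 0 < D \<and> strict_mono_on {x. 0 \<le> x \<and> ereal x < D} (psi l)}"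
  obtain D where D: "D > 0" "strict_mono_on {x. 0 \<le> x \<and> x < D} (psi l)"
    using psi_strict_mono_near_0 by blast
  then have "ereal D \<in> S" by (simp add: S_def)
  then have "ereal D \<le> Sup S" by (rule Sup_upper)
  then have "0 < Sup S" using D by (metis ereal_less(2) less_le_trans)
  moreover have "strict_mono_on {x. 0 \<le> x \<and> ereal x < Sup S} (psi l)"
    unfolding strict_mono_on_def
  proof (intro allI impI, elim conjE)
    fix x y assume xy: "x \<in> {x. 0 \<le> x \<and> ereal x < Sup S}" "y \<in> {x. 0 \<le> x \<and> ereal x < Sup S}" "x < y"
    then obtain E where E: "E \<in> S" "ereal y < E" by (auto simp: less_Sup_iff)
    then have "ereal x < E" using xy by (metis ereal_less_eq(3) less_imp_le order_le_less_trans)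
    then show "psi l x < psi l y"
      using E xy by (auto simp: S_def strict_mono_on_def)
  qed
  ultimately have "Sup S \<in> S" by (simp add: S_def)
  then have "Delta_max l = Sup S"
    unfolding Delta_max_def by (intro Greatest_equality) (auto simp: S_def intro: Sup_upper)
  with \<open>Sup S \<in> S\<close> show "0 < Delta_max l" "strict_mono_on {x. 0 \<le> x \<and> ereal x < Delta_max l} (psi l)"
    by (auto simp: S_def)
qed

lemma psi_less:
  assumes "0 \<le> x" "x < y" "ereal y < Delta_max l"
  shows "psi l x < psi l y"
proof -
  have "ereal x < Delta_max l" using assms by (metis ereal_less_eq(3) less_imp_le order_le_less_trans)
  then show ?thesis using Delta_max(2) assms by (auto simp: strict_mono_on_def)
qed

lemma psi_0: "psi l 0 = 0"
  by (simp add: psi_def)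

text \<open>The factor 1/2 in the range of \<open>\<delta>\<close> supplies the strict inequality.
  For finite \<open>Delta_max l\<close> this value itself serves; otherwise the limit is the
  supremum of \<open>psi l\<close>, and some value exceeds \<open>\<delta>\<close>.\<close>

lemma ex_psi_greater:
  assumes \<delta>: "0 < \<delta>" "ereal \<delta> \<le> psi_Delta_max l / 2"
  shows "\<exists>b\<ge>0. ereal b \<le> Delta_max l \<and> \<delta> < psi l b"
proof (cases "Delta_max l")
  case (real r)
  then have "0 \<le> r" using Delta_max(1) by simp
  moreover have "\<delta> \<le> psi l r / 2" using \<delta>(2) real by (simp add: psi_Delta_max_def)
  ultimately show ?thesis using real \<delta>(1) by (intro exI[of _ r]) auto
next
  case PInf
  let ?S = "SUP x\<in>{0..}. ereal (psi l x)"
  have mono_psi: "psi l x \<le> psi l y" if "0 \<le> x" "x \<le> y" for x y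
    using psi_less[of x y] that PInf by (cases "x = y") auto
  have "((\<lambda>x. ereal (psi l x)) \<longlongrightarrow> ?S) at_top"
  proof (rule order_tendstoI)
    fix a assume "a < ?S"
    then obtain x where x: "0 \<le> x" "a < ereal (psi l x)" by (auto simp: less_SUP_iff)
    show "\<forall>\<^sub>F y in at_top. a < ereal (psi l y)"
      using eventually_ge_at_top[of x]
    proof eventually_elim
      case (elim y)
      then have "ereal (psi l x) \<le> ereal (psi l y)" using mono_psi x by simp
      with x(2) show ?case by (rule less_le_trans)
    qed
  next
    fix a assume a: "?S < a"
    show "\<forall>\<^sub>F y in at_top. ereal (psi l y) < a"
      using eventually_ge_at_top[of 0]
    proof eventually_elim
      case (elim y)
      then have "ereal (psi l y) \<le> ?S" by (intro SUP_upper) auto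
      then show ?case using a by (rule le_less_trans)
    qed
  qed
  then have S: "psi_Delta_max l = ?S"
    using PInf by (simp add: psi_Delta_max_def tendsto_Lim)
  have "\<exists>b\<ge>0. \<delta> < psi l b"
  proof (rule ccontr)
    assume "\<not> (\<exists>b\<ge>0. \<delta> < psi l b)"
    then have "?S \<le> ereal \<delta>" by (intro SUP_least) (auto simp: not_less)
    then have "?S / 2 \<le> ereal \<delta> / 2" by (intro ereal_divide_right_mono) auto
    then have "ereal \<delta> \<le> ereal \<delta> / 2" using \<delta>(2) S by (metis order_trans)
    then show False using \<delta>(1) by simp
  qed
  then show ?thesis using PInf by auto
qed (use Delta_max(1) in auto)

lemma Delta_left:
  assumes \<delta>: "0 < \<delta>" "ereal \<delta> \<le> psi_Delta_max l / 2"
  shows "0 < Delta_left l \<delta>" "ereal (Delta_left l \<delta>) < Delta_max l" "psi l (Delta_left l \<delta>) = \<delta>"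
proof -
  obtain b where b: "0 \<le> b" "ereal b \<le> Delta_max l" "\<delta> < psi l b"
    using ex_psi_greater[OF assms] by blast
  obtain x where x: "0 \<le> x" "x \<le> b" "psi l x = \<delta>"
    using IVT'[of "psi l" 0 \<delta> b] b \<delta> psi_0 continuous_on_subset[OF psi_cont, of "{0..b}"] by auto
  then have "x < b" using b(3) by (cases "x = b") auto
  then have x_max: "ereal x < Delta_max l" using b(2) by (metis ereal_less_eq(3) less_le_trans not_le)
  have unique: "x' = x" if "0 \<le> x' \<and> ereal x' < Delta_max l \<and> psi l x' = \<delta>" for x'
    using that x x_max psi_less[of x x'] psi_less[of x' x] by (cases x x' rule: linorder_cases) auto
  have "Delta_left l \<delta> = x"
    unfolding Delta_left_def by (rule the_equality[OF _ unique]) (use x x_max in auto)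
  moreover have "0 < x" using x \<delta> psi_0 by (cases "x = 0") auto
  ultimately show "0 < Delta_left l \<delta>" "ereal (Delta_left l \<delta>) < Delta_max l" "psi l (Delta_left l \<delta>) = \<delta>"
    using x x_max by auto
qed

lemma le_Delta_left:
  assumes "0 < \<delta>" "ereal \<delta> \<le> psi_Delta_max l / 2" and "ereal t < Delta_max l" "psi l t \<le> \<delta>"
  shows "t \<le> Delta_left l \<delta>"
  using Delta_left[OF assms(1,2)] psi_less[of "Delta_left l \<delta>" t] assms(3,4)
  by (cases "t \<le> Delta_left l \<delta>") auto

text \<open>Beyond \<open>Delta_max l\<close>, continuity would make \<open>psi l\<close> take the
  value \<open>\<delta>\<close> at some \<open>x \<le> t \<le> M\<close>. Then
  \<open>Delta_right l \<delta> \<le> x\<close>, so \<open>2 * M \<le> M\<close> although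
  \<open>M\<close> is positive.\<close>

lemma less_Delta_max:
  assumes \<delta>: "0 < \<delta>" "ereal \<delta> \<le> psi_Delta_max l / 2"
    and t: "0 \<le> t" "t \<le> M" "psi l t \<le> \<delta>" and right: "ereal (2 * M) \<le> Delta_right l \<delta>"
  shows "ereal t < Delta_max l"
proof (rule ccontr)
  assume "\<not> ereal t < Delta_max l"
  then have max_le: "Delta_max l \<le> ereal t" by simp
  then obtain r where r: "Delta_max l = ereal r" using Delta_max(1) by (cases "Delta_max l") auto
  have r0: "0 < r" and rt: "r \<le> t" using Delta_max(1) max_le r by auto
  have "\<delta> \<le> psi l r" using \<delta> r by (simp add: psi_Delta_max_def)
  then obtain x where x: "r \<le> x" "x \<le> t" "psi l x = \<delta>"
    using IVT2'[of "psi l" t \<delta> r] rt t(3) r0 continuous_on_subset[OF psi_cont, of "{r..t}"] by auto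
  define A where "A = {x. Delta_max l \<le> ereal x \<and> psi l x = \<delta>}"
  have A: "A = {x \<in> {r..}. psi l x = \<delta>}" by (auto simp: A_def r)
  \<comment> \<open>Makes the infimum of the level set a member, so that \<open>LEAST\<close> in
    \<open>Delta_right\<close> denotes it.\<close>
  have "closed A"
    unfolding A using r0
    by (intro continuous_closed_preimage_constant continuous_on_subset[OF psi_cont]) auto
  have xA: "x \<in> A" using x by (simp add: A)
  have bdd: "bdd_below A" by (rule bdd_belowI[of _ r]) (auto simp: A)
  have "Inf A \<in> A" using closed_contains_Inf[OF _ bdd \<open>closed A\<close>] xA by blast
  then have "(LEAST x. x \<in> A) = Inf A"
    by (intro Least_equality) (auto intro: cInf_lower bdd)
  moreover have "Inf A \<le> x" by (rule cInf_lower[OF xA bdd])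
  moreover have "Delta_right l \<delta> = ereal (LEAST x. x \<in> A)"
    using xA by (auto simp: Delta_right_def A_def)
  ultimately have "2 * M \<le> x" using right by simp
  then show False using x t r0 rt by linarith
qed

end

section \<open>The algorithm\<close>

text \<open>The Riesz representative of the derivative \<open>D\<close> is
  \<open>adjoint D 1\<close>, which yields existence and uniqueness for the description in
  \<open>grad\<close>.\<close>

lemma GDERIV_THE:
  fixes F :: "'a::euclidean_space \<Rightarrow> real"
  assumes "F differentiable (at x)"
  shows "GDERIV F x :> (THE g. GDERIV F x :> g)"
proof -
  obtain D where D: "(F has_derivative D) (at x)" using assms by (auto simp: differentiable_def)
  have "D = (\<lambda>h. h \<bullet> adjoint D 1)"
    using adjoint_works[OF has_derivative_linear[OF D], of _ 1] by auto
  then have "GDERIV F x :> adjoint D 1"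
    unfolding gderiv_def by (rule has_derivative_eq_rhs[OF D])
  moreover have "g = adjoint D 1" if "GDERIV F x :> g" for g
  proof -
    have "(\<lambda>h. h \<bullet> g) = (\<lambda>h. h \<bullet> adjoint D 1)"
      using that calculation unfolding gderiv_def by (rule has_derivative_unique)
    then show ?thesis by (metis vector_eq_ldot)
  qed
  ultimately show ?thesis by (rule theI)
qed

lemma gen_smooth_growth_bound: "gen_smooth l f \<Longrightarrow> growth_bound l"
  unfolding gen_smooth_def growth_bound_def by blast

lemma gen_smooth_fun_real_of_ereal:
  fixes f :: "'a::euclidean_space \<Rightarrow> ereal"
  assumes proper: "\<And>x. f x \<noteq> -\<infinity>" and dom: "open (dom_fin f)"
    and conv: "convex_ext f" and smooth: "gen_smooth l f"
  shows "gen_smooth_fun (dom_fin f) (\<lambda>z. real_of_ereal (f z)) (grad f) (hess f) l"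
proof -
  interpret growth_bound l using smooth by (rule gen_smooth_growth_bound)
  let ?F = "\<lambda>z. real_of_ereal (f z)"
  have f_eq: "f x = ereal (?F x)" if "x \<in> dom_fin f" for x
    using that proper[of x] by (cases "f x") (auto simp: dom_fin_def)
  have deriv: "(?F has_derivative (\<lambda>h. h \<bullet> grad f x)) (at x)" if "x \<in> dom_fin f" for x
    using GDERIV_THE[of ?F x] smooth that by (simp add: gen_smooth_def grad_def gderiv_def)
  show ?thesis
  proof
    fix x assume x: "x \<in> dom_fin f"
    show "(?F has_derivative (\<lambda>h. h \<bullet> grad f x)) (at x)" by (rule deriv[OF x])
    show "(grad f has_derivative hess f x) (at x)"
      using smooth x by (simp add: gen_smooth_def hess_def frechet_derivative_works)
    show "onorm (hess f x) \<le> l (norm (grad f x))"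
      using smooth x by (simp add: gen_smooth_def)
  next
    fix x y assume x: "x \<in> dom_fin f" and y: "y \<in> dom_fin f"
    let ?\<phi> = "\<lambda>t::real. ?F (x + t *\<^sub>R (y - x))"
    have le: "?\<phi> t \<le> (1 - t) * ?F x + t * ?F y" if t: "0 \<le> t" "t \<le> 1" for t
    proof -
      have "x + t *\<^sub>R (y - x) = (1 - t) *\<^sub>R x + t *\<^sub>R y" by (simp add: algebra_simps)
      then have "f (x + t *\<^sub>R (y - x)) \<le> ereal (1 - t) * f x + ereal t * f y"
        using conv t by (simp add: convex_ext_def)
      moreover obtain a b where "f x = ereal a" "f y = ereal b" using f_eq x y by blast
      ultimately show ?thesis
        using proper[of "x + t *\<^sub>R (y - x)"] by (cases "f (x + t *\<^sub>R (y - x))") auto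
    qed
    have "((\<lambda>t. x + t *\<^sub>R (y - x)) has_derivative (\<lambda>t. t *\<^sub>R (y - x))) (at 0)"
      by (auto intro!: derivative_eq_intros)
    from has_derivative_compose[OF this, of ?F "\<lambda>h. h \<bullet> grad f x"] deriv[OF x]
    have "(?\<phi> has_derivative (\<lambda>t. t *\<^sub>R (y - x) \<bullet> grad f x)) (at 0)" by simp
    then have "(?\<phi> has_real_derivative (grad f x \<bullet> (y - x))) (at 0)"
      by (simp add: has_field_derivative_def inner_commute mult_commute_abs)
    \<comment> \<open>The tangent inequality is the limit of the chord inequality for right
      difference quotients.\<close>
    then have "((\<lambda>t. (?\<phi> t - ?\<phi> 0) / t) \<longlongrightarrow> grad f x \<bullet> (y - x)) (at_right 0)"
      using filterlim_at_split[of _ "nhds (grad f x \<bullet> (y - x))" "0::real"]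
      by (simp add: has_field_derivative_iff)
    moreover have "\<forall>\<^sub>F t in at_right 0. (?\<phi> t - ?\<phi> 0) / t \<le> ?F y - ?F x"
      using eventually_at_right_real[of 0 1]
    proof (rule eventually_mono)
      fix t :: real assume t: "t \<in> {0<..<1}"
      then have "?\<phi> t - ?\<phi> 0 \<le> (?F y - ?F x) * t"
        using le[of t] by (simp add: algebra_simps)
      then show "(?\<phi> t - ?\<phi> 0) / t \<le> ?F y - ?F x"
        using t by (simp add: pos_divide_le_eq)
    qed simp
    ultimately have "grad f x \<bullet> (y - x) \<le> ?F y - ?F x"
      by (rule tendsto_upperbound) simp
    then show "?F x + grad f x \<bullet> (y - x) \<le> ?F y" by simp
  next
    fix c
    \<comment> \<open>A point of the closure with \<open>f x \<le> ereal c\<close> has a finite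
      value and so lies in the domain. Continuity of \<open>f\<close> on the closure then makes the
      sublevel set closed.\<close>
    have "{x \<in> dom_fin f. ?F x \<le> c} = closure (dom_fin f) \<inter> f -` {..ereal c}"
    proof (intro set_eqI iffI)
      fix x assume "x \<in> {x \<in> dom_fin f. ?F x \<le> c}"
      then show "x \<in> closure (dom_fin f) \<inter> f -` {..ereal c}"
        using proper[of x] closure_subset[of "dom_fin f"] by (cases "f x") (auto simp: dom_fin_def)
    next
      fix x assume "x \<in> closure (dom_fin f) \<inter> f -` {..ereal c}"
      then show "x \<in> {x \<in> dom_fin f. ?F x \<le> c}"
        using proper[of x] by (cases "f x") (auto simp: dom_fin_def)
    qed
    moreover have "closed (closure (dom_fin f) \<inter> f -` {..ereal c})"
      using smooth by (intro continuous_closed_preimage) (auto simp: gen_smooth_def)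
    ultimately show "closed {x \<in> dom_fin f. ?F x \<le> c}" by simp
  next
    show "l s \<le> l t" if "0 \<le> s" "s \<le> t" for s t
      using that by (intro mono_onD[OF mono]) auto
  qed (fact dom pos cont)+
qed

lemma acc_Gamma_0: "acc_Gamma l 0 R k = 0"
  by (induction k) auto

section \<open>Invariants of the accelerated phase\<close>

locale acc_setting = gen_smooth_fun "dom_fin f" F "grad f" H l + growth_bound l
  for f :: "'a::euclidean_space \<Rightarrow> ereal" and F H l +
  fixes xs xb :: 'a and R M \<delta> :: real
  assumes dom_convex: "convex (dom_fin f)" and xs: "xs \<in> dom_fin f"
    and min: "\<And>z. z \<in> dom_fin f \<Longrightarrow> F xs \<le> F z" and R: "0 < R"
    and xb: "xb \<in> dom_fin f" "norm (xb - xs) \<le> R" "F xb - F xs \<le> \<delta> / 2"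
    and M: "norm (grad f xb) \<le> M"
    and \<delta>: "0 < \<delta>" "ereal \<delta> \<le> psi_Delta_max l / 2"
    and left: "l (4 * Delta_left l \<delta>) \<le> 2 * l 0"
    and right: "ereal (2 * M) \<le> Delta_right l \<delta>"
begin

text \<open>\<open>gradient_gap\<close> evaluates \<open>l\<close> at twice the gradient norm;
  monotonicity passes to the factor 4 in \<open>psi\<close>.\<close>

lemma psi_gradient_le:
  assumes "z \<in> dom_fin f"
  shows "psi l (norm (grad f z)) \<le> F z - F xs"
proof -
  have "psi l (norm (grad f z)) \<le> (norm (grad f z))\<^sup>2 / (2 * l (2 * norm (grad f z)))"
    unfolding psi_def by (intro divide_left_mono mult_left_mono mult_pos_pos l_mono l_pos) auto
  also have "\<dots> \<le> F z - F xs"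
    by (rule gradient_gap[OF assms xs gradient_minimizer[OF xs min]])
  finally show ?thesis .
qed

lemma xb_gradient: "norm (grad f xb) \<le> Delta_left l \<delta>"
proof -
  have "psi l (norm (grad f xb)) \<le> \<delta>" using psi_gradient_le[OF xb(1)] xb(3) \<delta>(1) by linarith
  then show ?thesis
    using less_Delta_max[OF \<delta> norm_ge_zero M _ right] by (intro le_Delta_left[OF \<delta>]) auto
qed

lemma acc_invariant:
  defines "y k \<equiv> fst (acc_iter l f \<delta> R xb k)" and "u k \<equiv> snd (acc_iter l f \<delta> R xb k)"
    and "\<Gamma> k \<equiv> acc_Gamma l \<delta> R k"
  shows "y k \<in> dom_fin f \<and> norm (grad f (y k)) \<le> Delta_left l \<delta> \<and> \<Gamma> k * R\<^sup>2 \<le> \<delta> \<and>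
    F (y k) - F xs + \<Gamma> k / 2 * (norm (u k - xs))\<^sup>2 \<le> \<Gamma> k * R\<^sup>2"
proof (induction k)
  case 0
  \<comment> \<open>The function gap and the weighted distance each account for half of
    \<open>\<Gamma> 0 * R\<^sup>2 = \<delta>\<close>.\<close>
  have "\<Gamma> 0 / 2 * (norm (xb - xs))\<^sup>2 \<le> \<Gamma> 0 / 2 * R\<^sup>2"
    using xb(2) \<delta>(1) by (intro mult_left_mono power_mono) (auto simp: \<Gamma>_def)
  moreover have "\<Gamma> 0 * R\<^sup>2 = \<delta>" using R by (simp add: \<Gamma>_def)
  ultimately show ?case using xb xb_gradient by (simp add: y_def u_def)
next
  case (Suc k)
  let ?D = "Delta_left l \<delta>" and ?\<gamma> = "acc_gamma l" and ?\<alpha> = "acc_alpha l \<delta> R k"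
  have l0: "0 < l 0" by (rule l_pos) simp
  have \<gamma>: "0 < ?\<gamma>" "l (4 * ?D) \<le> 1 / ?\<gamma>" using l0 left by (auto simp: acc_gamma_def)
  have \<Gamma>: "0 < \<Gamma> k" unfolding \<Gamma>_def using \<delta>(1) R l0 by (rule acc_Gamma_pos)
  have \<alpha>: "0 < ?\<alpha>" "?\<alpha>\<^sup>2 = ?\<gamma> * \<Gamma> k"
    using \<gamma>(1) \<Gamma> by (auto simp: acc_alpha_def \<Gamma>_def)
  have D: "0 < ?D" by (rule Delta_left[OF \<delta>])
  have \<Gamma>_Suc: "\<Gamma> (Suc k) = \<Gamma> k / (1 + ?\<alpha>)" by (simp add: \<Gamma>_def acc_alpha_def)
  have y_Suc: "y (Suc k) = (1 / (1 + ?\<alpha>)) *\<^sub>R y k + (?\<alpha> / (1 + ?\<alpha>)) *\<^sub>R u k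
      - (?\<gamma> / (1 + ?\<alpha>)) *\<^sub>R grad f (y k)"
    by (simp add: y_def u_def Let_def)
  have u_Suc: "u (Suc k) = closest_point (closure (dom_fin f)) (u k - (?\<alpha> / \<Gamma> k) *\<^sub>R grad f (y (Suc k)))"
    unfolding y_Suc by (simp add: y_def u_def \<Gamma>_def Let_def)
  have eq: "(1 + ?\<alpha>) *\<^sub>R y (Suc k) = y k + ?\<alpha> *\<^sub>R u k - ?\<gamma> *\<^sub>R grad f (y k)"
    unfolding y_Suc using \<alpha>(1) by (simp add: scaleR_add_right scaleR_diff_right)
  \<comment> \<open>On \<open>[0, b)\<close> strict monotonicity of \<open>psi l\<close> turns a gap
    of at most \<open>\<delta>\<close> into a gradient norm of at most \<open>?D\<close>, as
    \<open>acc_path\<close> demands.\<close>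
  obtain b where b: "?D < b" "ereal b \<le> Delta_max l"
    using Delta_left(2)[OF \<delta>] by (cases "Delta_max l") (auto intro: that[of "?D + 1"])
  have small: "norm (grad f z) \<le> ?D"
    if "z \<in> dom_fin f" "F z - F xs \<le> \<delta>" "norm (grad f z) < b" for z
  proof (rule le_Delta_left[OF \<delta>])
    show "ereal (norm (grad f z)) < Delta_max l" using that(3) by (intro less_le_trans[OF _ b(2)]) simp
  qed (use psi_gradient_le[OF that(1)] that(2) in simp)
  have pot: "F (y k) - F xs + \<Gamma> k / 2 * (norm (u k - xs))\<^sup>2 \<le> \<delta>" using Suc by linarith
  have y': "y (Suc k) \<in> dom_fin f" "norm (grad f (y (Suc k))) \<le> ?D"
    using acc_path[OF _ _ xs min D \<gamma>(2,1) \<Gamma> \<alpha> pot b(1) small eq] Suc by auto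
  have "(u k - (?\<alpha> / \<Gamma> k) *\<^sub>R grad f (y (Suc k)) - u (Suc k)) \<bullet> (xs - u (Suc k)) \<le> 0"
    unfolding u_Suc using xs closure_subset[of "dom_fin f"] dom_convex
    by (intro closest_point_dot convex_closure) auto
  then have "(1 + ?\<alpha>) * (F (y (Suc k)) - F xs) + \<Gamma> k / 2 * (norm (u (Suc k) - xs))\<^sup>2 \<le> \<Gamma> k * R\<^sup>2"
    using acc_potential[OF _ _ y' xs D \<gamma>(2,1) \<Gamma> \<alpha> eq] Suc by force
  moreover have \<Gamma>_eq: "\<Gamma> k = (1 + ?\<alpha>) * \<Gamma> (Suc k)" using \<alpha>(1) by (simp add: \<Gamma>_Suc)
  ultimately have "(1 + ?\<alpha>) * (F (y (Suc k)) - F xs + \<Gamma> (Suc k) / 2 * (norm (u (Suc k) - xs))\<^sup>2)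
      \<le> (1 + ?\<alpha>) * (\<Gamma> (Suc k) * R\<^sup>2)"
    by (simp add: algebra_simps)
  then have "F (y (Suc k)) - F xs + \<Gamma> (Suc k) / 2 * (norm (u (Suc k) - xs))\<^sup>2 \<le> \<Gamma> (Suc k) * R\<^sup>2"
    using \<alpha>(1) by simp
  moreover have "\<Gamma> (Suc k) \<le> \<Gamma> k / 1"
    unfolding \<Gamma>_Suc using \<alpha>(1) \<Gamma> by (intro divide_left_mono) auto
  then have "\<Gamma> (Suc k) * R\<^sup>2 \<le> \<delta>"
    using Suc mult_right_mono[of "\<Gamma> (Suc k)" "\<Gamma> k" "R\<^sup>2"] by simp
  ultimately show ?case using y' by blast
qed

end

section \<open>Combination of the two phases\<close>

theorem theorem5p1:
  fixes f :: "'a::euclidean_space \<Rightarrow> ereal"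
    and l :: "real \<Rightarrow> real"
    and xs x0 :: 'a
    and R M \<delta> :: real
  assumes proper: "\<And>x. f x \<noteq> -\<infinity>"
    and dom: "open (dom_fin f)" "convex (dom_fin f)" "dom_fin f \<noteq> {}"
    and conv: "convex_ext f"
    and smooth: "gen_smooth l f"
    and minimizer: "\<And>x. f xs \<le> f x"
    and x0: "x0 \<in> dom_fin f"
    and R: "0 < R" "norm (x0 - xs) \<le> R"
    and M: "\<And>x. f x - f xs \<le> f x0 - f xs \<Longrightarrow> norm (x - xs) \<le> 2 * R \<Longrightarrow> norm (grad f x) \<le> M"
    and delta_range: "0 \<le> \<delta>" "ereal \<delta> \<le> psi_Delta_max l / 2"
    and delta_left: "l (4 * Delta_left l \<delta>) \<le> 2 * l 0"
    and delta_right: "ereal (2 * M) \<le> Delta_right l \<delta>"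
    and delta_gap: "ereal \<delta> \<le> f x0 - f xs"
    and degenerate: "\<delta> = 0 \<Longrightarrow> \<exists>j. phase1_reached l f xs x0 \<delta> j"
  shows "(\<exists>j. phase1_reached l f xs x0 \<delta> j) \<and>
    (\<forall>k::nat. k_bar l \<delta> R \<le> real k \<longrightarrow>
       f (alg_y l f xs x0 \<delta> R (k + 1)) - f xs \<le> ereal (acc_Gamma l \<delta> R (k + 1) * R\<^sup>2) \<and>
       acc_Gamma l \<delta> R (k + 1) * R\<^sup>2 \<le> 18 * l 0 * R\<^sup>2 / (real (k + 1) - k_bar l \<delta> R)\<^sup>2)"
proof -
  let ?F = "\<lambda>z. real_of_ereal (f z)"
  interpret growth_bound l using smooth by (rule gen_smooth_growth_bound)
  interpret gen_smooth_fun "dom_fin f" ?F "grad f" "hess f" l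
    by (rule gen_smooth_fun_real_of_ereal[OF proper dom(1) conv smooth])
  have f_eq: "f x = ereal (?F x)" if "x \<in> dom_fin f" for x
    using that proper[of x] by (cases "f x") (auto simp: dom_fin_def)
  have xs: "xs \<in> dom_fin f"
    using minimizer[of x0] x0 by (auto simp: dom_fin_def intro: le_less_trans)
  have min: "?F xs \<le> ?F z" if "z \<in> dom_fin f" for z
    using minimizer[of z] f_eq[OF that] f_eq[OF xs] by (metis ereal_less_eq(3))
  have grad_xs: "grad f xs = 0" by (rule gradient_minimizer[OF xs min])
  have gap: "f x - f xs = ereal (?F x - ?F xs)" if "x \<in> dom_fin f" for x
    using f_eq[OF that] f_eq[OF xs] by (metis ereal_minus(1))
  let ?x = "gd_iter l f x0"
  have seq: "?x j \<in> dom_fin f" "?F (?x j) \<le> ?F x0" "norm (?x j - xs) \<le> R" for j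
    using gd_sequence[of ?x xs R j] x0 xs grad_xs R by auto
  \<comment> \<open>Descent and monotone distance keep every iterate in the region over which
    \<open>M\<close> bounds the gradient.\<close>
  have grad_le: "norm (grad f (?x j)) \<le> M" for j
    using seq[of j] R gap[OF x0] by (intro M) (auto simp: gap)
  have reached_iff: "phase1_reached l f xs x0 \<delta> j \<longleftrightarrow> ?F (?x j) - ?F xs \<le> \<delta> / 2" for j
    unfolding phase1_reached_def gap[OF seq(1)] by simp
  have reached: "\<exists>j. phase1_reached l f xs x0 \<delta> j"
  proof (cases "\<delta> = 0")
    case False
    then show ?thesis
      unfolding reached_iff using x0 xs grad_xs grad_le delta_range(1)
      by (intro gd_terminates) auto
  qed (use degenerate in blast)
  define xb where "xb = phase1_point l f xs x0 \<delta>"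
  obtain j where j: "xb = ?x j" "phase1_reached l f xs x0 \<delta> j"
    using LeastI_ex[OF reached] by (auto simp: xb_def phase1_point_def)
  have xb: "xb \<in> dom_fin f" "norm (xb - xs) \<le> R" "?F xb - ?F xs \<le> \<delta> / 2" "norm (grad f xb) \<le> M"
    using seq grad_le j unfolding reached_iff by auto
  have l0: "0 < l 0" by (rule l_pos) simp
  have "f (alg_y l f xs x0 \<delta> R (k + 1)) - f xs \<le> ereal (acc_Gamma l \<delta> R (k + 1) * R\<^sup>2) \<and>
      acc_Gamma l \<delta> R (k + 1) * R\<^sup>2 \<le> 18 * l 0 * R\<^sup>2 / (real (k + 1) - k_bar l \<delta> R)\<^sup>2"
    if k: "k_bar l \<delta> R \<le> real k" for k
  proof (cases "\<delta> = 0")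
    case True
    \<comment> \<open>For \<open>\<delta> = 0\<close> the point \<open>xb\<close> is a minimizer, so
      its gradient vanishes and the iteration is constant; all \<open>\<Gamma>\<^sub>k\<close> are
      zero as well.\<close>
    have "?F xb \<le> ?F z" if "z \<in> dom_fin f" for z
      using xb(3) min[OF that] True by linarith
    then have "grad f xb = 0" by (intro gradient_minimizer[OF xb(1)])
    then have "acc_iter l f \<delta> R xb n = (xb, xb)" for n
      using xb(1) closure_subset[of "dom_fin f"] True
      by (induction n) (auto simp: acc_alpha_def acc_Gamma_0 closest_point_self)
    then have "alg_y l f xs x0 \<delta> R (k + 1) = xb"
      unfolding alg_y_def xb_def[symmetric] by (simp del: acc_iter.simps)
    then show ?thesis
      using True xb(3) l0 by (simp add: gap[OF xb(1)] acc_Gamma_0 del: acc_Gamma.simps)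
  next
    case False
    then have \<delta>_pos: "0 < \<delta>" using delta_range(1) by simp
    interpret acc_setting f ?F "hess f" l xs xb R M \<delta>
      by unfold_locales (use dom xs min R xb \<delta>_pos delta_range delta_left delta_right in auto)
    \<comment> \<open>Allows the distance term of the invariant to be dropped, leaving the bound on
      the function gap.\<close>
    have "0 \<le> acc_Gamma l \<delta> R (k + 1) / 2 * (norm (snd (acc_iter l f \<delta> R xb (k + 1)) - xs))\<^sup>2"
      using acc_Gamma_pos[of \<delta> R l "k + 1", OF \<delta>_pos R(1) l0]
      by (simp del: acc_iter.simps acc_Gamma.simps)
    moreover have "18 * l 0 / (real (k + 1) - k_bar l \<delta> R)\<^sup>2 * R\<^sup>2 =
        18 * l 0 * R\<^sup>2 / (real (k + 1) - k_bar l \<delta> R)\<^sup>2" by simp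
    ultimately show ?thesis
      using acc_invariant[of "k + 1"] mult_right_mono[OF acc_Gamma_rate[of \<delta> R l k, OF \<delta>_pos R(1) l0 k], of "R\<^sup>2"]
      unfolding alg_y_def xb_def[symmetric] by (auto simp: gap simp del: acc_iter.simps acc_Gamma.simps)
  qed
  then show ?thesis using reached by blast
qed

end
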